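(* Let $\beta\in(0,1)$, $\eta\ge 0$, $\kappa\ge 0$, $\gamma>\eta^2$, and let $T$ be the closed-loop system operator in $\mathbb{X}$ defined in the context. The spectrum of $T$ is symmetric with respect to the real axis and lies in the closed left half-plane $\{\lambda\in\mathbb{C}:\operatorname{Re}\lambda\le 0\}$, excluding the origin. When $\eta,\kappa>0$ the spectrum is confined to the open left half-plane $\{\lambda\in\mathbb{C}:\operatorname{Re}\lambda<0\}$.
   Context: Standing parameters: $\beta\in(0,1)$, $\eta\ge0$, $\kappa\ge0$, $\gamma>\eta^2$ (real numbers). $H^k(0,1)$ is the usual (complex) $L_2$-Sobolev space and $\mathring H^k(0,1)=\{w\in H^k(0,1): w(0)=0\}$, $k=1,2$. State space: $\mathbb{X}=\mathring H^2(0,1)\times L_2(0,1)$, with inner product, for $x=(w,v)$, $\tilde x=(\tilde w,\tilde v)$, $$\langle x,\tilde x\rangle=\int_0^1\big[w''\overline{\tilde w''}+(\gamma-\eta^2)w'\overline{\tilde w'}+v\overline{\tilde v}\big]ds,\qquad \|x\|=\langle x,x\rangle^{1/2}.$$ Operator: $T=A+B$ with $$A\begin{pmatrix}w\\ v\end{pmatrix}=\begin{pmatrix}v\\ -w^{(4)}+(\gamma-\eta^2)w''\end{pmatrix},\qquad B\begin{pmatrix}w\\ v\end{pmatrix}=\begin{pmatrix}0\\ -2\beta\eta v'\end{pmatrix},$$ where $D(A)$ is the set of $(w,v)\in\mathbb{X}$ with $w\in H^4(0,1)\cap\mathring H^2(0,1)$, $v\in\mathring H^2(0,1)$, $w''(0)=0$,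 $w''(1)+\kappa v'(1)=0$, $w^{(3)}(1)-(\gamma-\eta^2)w'(1)=0$; $D(B)=\mathring H^2(0,1)\times\mathring H^1(0,1)$; and $D(T)=D(A)$. *)

theory Defs
  imports "HOL-Analysis.Analysis"
begin

section \<open>The Hilbert space \<open>L\<^sub>2(0,1)\<close>\<close>

abbreviation unit_ivl :: "real measure" where
  "unit_ivl \<equiv> lebesgue_on {0<..<1}"

definition square_integrable :: "(real \<Rightarrow> complex) \<Rightarrow> bool" where
  "square_integrable f \<longleftrightarrow>
     f \<in> borel_measurable unit_ivl \<and> integrable unit_ivl (\<lambda>s. (cmod (f s))\<^sup>2)"

definition l2_rel :: "(real \<Rightarrow> complex) \<Rightarrow> (real \<Rightarrow> complex) \<Rightarrow> bool" where
  "l2_rel f g \<longleftrightarrow>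
     square_integrable f \<and> square_integrable g \<and> (AE s in unit_ivl. f s = g s)"

lemma square_integrable_zero: "square_integrable (\<lambda>_. 0)"
  by (simp add: square_integrable_def)

lemma square_integrable_scale:
  assumes "square_integrable f"
  shows "square_integrable (\<lambda>s. c * f s)"
  using assms by (auto simp: square_integrable_def norm_mult power_mult_distrib)

lemma square_integrable_add:
  assumes f: "square_integrable f" and g: "square_integrable g"
  shows "square_integrable (\<lambda>s. f s + g s)"
proof -
  have [measurable]: "f \<in> borel_measurable unit_ivl" "g \<in> borel_measurable unit_ivl"
    using f g by (auto simp: square_integrable_def)
  have dom: "integrable unit_ivl (\<lambda>s. 2 * (cmod (f s))\<^sup>2 + 2 * (cmod (g s))\<^sup>2)"
    using f g by (auto simp: square_integrable_def)
  have "(cmod (f s + g s))\<^sup>2 \<le> 2 * (cmod (f s))\<^sup>2 + 2 * (cmod (g s))\<^sup>2" for s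
  proof -
    have "(cmod (f s + g s))\<^sup>2 \<le> (cmod (f s) + cmod (g s))\<^sup>2"
      by (intro power_mono norm_triangle_ineq) auto
    also have "\<dots> \<le> 2 * (cmod (f s))\<^sup>2 + 2 * (cmod (g s))\<^sup>2"
      using sum_squares_bound[of "cmod (f s)" "cmod (g s)"] by (simp add: power2_sum)
    finally show ?thesis .
  qed
  then have "integrable unit_ivl (\<lambda>s. (cmod (f s + g s))\<^sup>2)"
    by (intro Bochner_Integration.integrable_bound[OF dom]) auto
  then show ?thesis
    by (simp add: square_integrable_def)
qed

quotient_type L2 = "real \<Rightarrow> complex" / partial: l2_rel
proof (rule part_equivpI)
  show "\<exists>f. l2_rel f f"
    using square_integrable_zero by (auto simp: l2_rel_def)
  show "symp l2_rel"
    by (rule sympI) (auto simp: l2_rel_def)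
  show "transp l2_rel"
    by (rule transpI) (auto simp: l2_rel_def)
qed

instantiation L2 :: ab_group_add
begin

lift_definition zero_L2 :: L2 is "\<lambda>_. 0"
  by (simp add: l2_rel_def square_integrable_zero)

lift_definition plus_L2 :: "L2 \<Rightarrow> L2 \<Rightarrow> L2" is "\<lambda>f g s. f s + g s"
  by (auto simp: l2_rel_def intro: square_integrable_add)

lift_definition uminus_L2 :: "L2 \<Rightarrow> L2" is "\<lambda>f s. - f s"
  using square_integrable_scale[where c = "-1"] by (auto simp: l2_rel_def)

definition minus_L2 :: "L2 \<Rightarrow> L2 \<Rightarrow> L2" where
  "minus_L2 u v = u + (- v)"

instance
proof
  fix a b c :: L2
  show "a + b + c = a + (b + c)"
    by transfer (auto simp: l2_rel_def add.assoc intro!: square_integrable_add)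
  show "a + b = b + a"
    by transfer (auto simp: l2_rel_def add.commute intro!: square_integrable_add)
  show "0 + a = a"
    by transfer (auto simp: l2_rel_def)
  show "- a + a = 0"
    by transfer (auto simp: l2_rel_def square_integrable_zero)
  show "a - b = a + - b"
    by (simp add: minus_L2_def)
qed

end

lift_definition l2_scale :: "complex \<Rightarrow> L2 \<Rightarrow> L2" is "\<lambda>c f s. c * f s"
  by (auto simp: l2_rel_def intro: square_integrable_scale)

interpretation L2: vector_space l2_scale
proof
  fix a b :: complex and x y :: L2
  show "l2_scale a (x + y) = l2_scale a x + l2_scale a y"
    by transfer (auto simp: l2_rel_def distrib_left
        intro!: square_integrable_add square_integrable_scale)
  show "l2_scale (a + b) x = l2_scale a x + l2_scale b x"
    by transfer (auto simp: l2_rel_def distrib_right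
        intro!: square_integrable_add square_integrable_scale)
  show "l2_scale a (l2_scale b x) = l2_scale (a * b) x"
    by transfer (auto simp: l2_rel_def mult.assoc intro!: square_integrable_scale)
  show "l2_scale 1 x = x"
    by transfer (auto simp: l2_rel_def)
qed

lift_definition l2_inner :: "L2 \<Rightarrow> L2 \<Rightarrow> complex" is
  "\<lambda>f g. LINT s|unit_ivl. f s * cnj (g s)"
proof -
  fix f f' g g' :: "real \<Rightarrow> complex"
  assume r: "l2_rel f f'" "l2_rel g g'"
  then have [measurable]: "f \<in> borel_measurable unit_ivl" "f' \<in> borel_measurable unit_ivl"
      "g \<in> borel_measurable unit_ivl" "g' \<in> borel_measurable unit_ivl"
    by (auto simp: l2_rel_def square_integrable_def)
  have [measurable]: "cnj \<in> borel_measurable borel"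
    by (intro borel_measurable_continuous_onI continuous_intros)
  have "AE s in unit_ivl. f s = f' s" "AE s in unit_ivl. g s = g' s"
    using r by (auto simp: l2_rel_def)
  then have "AE s in unit_ivl. f s * cnj (g s) = f' s * cnj (g' s)"
    by eventually_elim simp
  then show "(LINT s|unit_ivl. f s * cnj (g s)) = (LINT s|unit_ivl. f' s * cnj (g' s))"
    by (intro integral_cong_AE) measurable
qed

section \<open>Sobolev spaces on \<open>(0,1)\<close>\<close>

text \<open>Test functions are continuously differentiable with compact support in \<open>(0,1)\<close>. Taking
  real-valued ones is no restriction, as the defining identity of the weak derivative is linear in
  the test function.\<close>

definition test_function :: "(real \<Rightarrow> real) \<Rightarrow> (real \<Rightarrow> real) \<Rightarrow> bool" where
  "test_function \<phi> \<phi>' \<longleftrightarrow>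
     (\<forall>s. (\<phi> has_real_derivative \<phi>' s) (at s)) \<and> continuous_on UNIV \<phi>' \<and>
     (\<exists>a b. 0 < a \<and> b < 1 \<and> (\<forall>s. s \<notin> {a..b} \<longrightarrow> \<phi> s = 0))"

lift_definition has_weak_deriv :: "L2 \<Rightarrow> L2 \<Rightarrow> bool" is
  "\<lambda>u g. \<forall>\<phi> \<phi>'. test_function \<phi> \<phi>' \<longrightarrow>
     (LINT s|unit_ivl. u s * of_real (\<phi>' s)) = - (LINT s|unit_ivl. g s * of_real (\<phi> s))"
proof -
  fix u v g h :: "real \<Rightarrow> complex"
  assume r: "l2_rel u v" "l2_rel g h"
  have *: "(LINT s|unit_ivl. p s * of_real (\<psi> s)) = (LINT s|unit_ivl. q s * of_real (\<psi> s))"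
    if pq: "l2_rel p q" and c: "continuous_on UNIV \<psi>" for p q :: "real \<Rightarrow> complex" and \<psi> :: "real \<Rightarrow> real"
  proof -
    have "\<psi> \<in> borel_measurable lebesgue"
      using borel_measurable_continuous_onI[OF c] by (intro measurable_completion) simp
    then have [measurable]: "\<psi> \<in> borel_measurable unit_ivl"
      by (rule measurable_restrict_space1)
    have [measurable]: "p \<in> borel_measurable unit_ivl" "q \<in> borel_measurable unit_ivl"
      using pq by (auto simp: l2_rel_def square_integrable_def)
    have "AE s in unit_ivl. p s = q s"
      using pq by (simp add: l2_rel_def)
    then have "AE s in unit_ivl. p s * of_real (\<psi> s) = q s * of_real (\<psi> s)"
      by eventually_elim simp
    then show ?thesis
      by (intro integral_cong_AE) measurable
  qed
  have "(LINT s|unit_ivl. u s * of_real (\<phi>' s)) = (LINT s|unit_ivl. v s * of_real (\<phi>' s))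
      \<and> (LINT s|unit_ivl. g s * of_real (\<phi> s)) = (LINT s|unit_ivl. h s * of_real (\<phi> s))"
    if t: "test_function \<phi> \<phi>'" for \<phi> \<phi>'
  proof -
    have "continuous_on UNIV \<phi>'" "continuous_on UNIV \<phi>"
      using t by (auto simp: test_function_def intro!: continuous_at_imp_continuous_on DERIV_isCont)
    then show ?thesis
      using * r by blast
  qed
  then show "(\<forall>\<phi> \<phi>'. test_function \<phi> \<phi>' \<longrightarrow>
        (LINT s|unit_ivl. u s * of_real (\<phi>' s)) = - (LINT s|unit_ivl. g s * of_real (\<phi> s))) =
      (\<forall>\<phi> \<phi>'. test_function \<phi> \<phi>' \<longrightarrow>
        (LINT s|unit_ivl. v s * of_real (\<phi>' s)) = - (LINT s|unit_ivl. h s * of_real (\<phi> s)))"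
    by auto
qed

text \<open>Meaningful only if a weak derivative in \<open>L\<^sub>2(0,1)\<close> exists; it is then unique.\<close>

definition weak_deriv :: "L2 \<Rightarrow> L2" where
  "weak_deriv u = (THE g. has_weak_deriv u g)"

primrec sobolev :: "nat \<Rightarrow> L2 set" where
  "sobolev 0 = UNIV"
| "sobolev (Suc k) = {u. \<exists>g. has_weak_deriv u g \<and> g \<in> sobolev k}"

lift_definition has_continuous_rep :: "L2 \<Rightarrow> (real \<Rightarrow> complex) \<Rightarrow> bool" is
  "\<lambda>u f. continuous_on {0..1} f \<and> (AE s in unit_ivl. u s = f s)"
proof -
  fix u v :: "real \<Rightarrow> complex"
  assume "l2_rel u v"
  then have *: "AE s in unit_ivl. u s = v s"
    by (simp add: l2_rel_def)
  have "(AE s in unit_ivl. u s = f s) \<longleftrightarrow> (AE s in unit_ivl. v s = f s)" for f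
    using * by (auto elim: eventually_elim2)
  then show "(\<lambda>f. continuous_on {0..1} f \<and> (AE s in unit_ivl. u s = f s)) =
      (\<lambda>f. continuous_on {0..1} f \<and> (AE s in unit_ivl. v s = f s))"
    by simp
qed

text \<open>Point values \<open>u(s)\<close>, \<open>s \<in> [0,1]\<close>, of an element of \<open>H\<^sup>k(0,1)\<close>, \<open>k \<ge> 1\<close>, are those of its
  (unique) representative that is continuous on \<open>[0,1]\<close>.\<close>

definition point_value :: "L2 \<Rightarrow> real \<Rightarrow> complex" where
  "point_value u s = (THE c. \<exists>f. has_continuous_rep u f \<and> c = f s)"

definition sobolev0 :: "nat \<Rightarrow> L2 set" where
  "sobolev0 k = {w \<in> sobolev k. point_value w 0 = 0}"

section \<open>Spectrum of an unbounded operator\<close>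

text \<open>For a linear operator \<open>T\<close> with domain \<open>D\<close> in the complex normed space with carrier \<open>X\<close>,
  scalar multiplication \<open>smul\<close> and norm \<open>nrm\<close>: \<open>z\<close> is in the resolvent set if \<open>zI - T\<close> maps \<open>D\<close>
  bijectively onto \<open>X\<close> and its inverse is bounded.\<close>

definition resolvent_set ::
  "(complex \<Rightarrow> 'a \<Rightarrow> 'a) \<Rightarrow> ('a \<Rightarrow> real) \<Rightarrow> 'a set \<Rightarrow> 'a set \<Rightarrow> ('a \<Rightarrow> 'a::ab_group_add) \<Rightarrow> complex set" where
  "resolvent_set smul nrm X D T =
     {z. bij_betw (\<lambda>x. smul z x - T x) D X \<and>
         (\<exists>C. \<forall>y\<in>X. nrm (inv_into D (\<lambda>x. smul z x - T x) y) \<le> C * nrm y)}"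

definition spectrum ::
  "(complex \<Rightarrow> 'a \<Rightarrow> 'a) \<Rightarrow> ('a \<Rightarrow> real) \<Rightarrow> 'a set \<Rightarrow> 'a set \<Rightarrow> ('a \<Rightarrow> 'a::ab_group_add) \<Rightarrow> complex set" where
  "spectrum smul nrm X D T = - resolvent_set smul nrm X D T"

section \<open>The closed-loop system operator\<close>

definition X_space :: "(L2 \<times> L2) set" where
  "X_space = sobolev0 2 \<times> UNIV"

definition X_scale :: "complex \<Rightarrow> L2 \<times> L2 \<Rightarrow> L2 \<times> L2" where
  "X_scale c = (\<lambda>(w, v). (l2_scale c w, l2_scale c v))"

definition X_inner :: "real \<Rightarrow> real \<Rightarrow> L2 \<times> L2 \<Rightarrow> L2 \<times> L2 \<Rightarrow> complex" where
  "X_inner \<eta> \<gamma> = (\<lambda>(w, v) (w', v').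
     l2_inner (weak_deriv (weak_deriv w)) (weak_deriv (weak_deriv w')) +
     of_real (\<gamma> - \<eta>\<^sup>2) * l2_inner (weak_deriv w) (weak_deriv w') +
     l2_inner v v')"

definition X_norm :: "real \<Rightarrow> real \<Rightarrow> L2 \<times> L2 \<Rightarrow> real" where
  "X_norm \<eta> \<gamma> x = sqrt (Re (X_inner \<eta> \<gamma> x x))"

definition A_op :: "real \<Rightarrow> real \<Rightarrow> L2 \<times> L2 \<Rightarrow> L2 \<times> L2" where
  "A_op \<eta> \<gamma> = (\<lambda>(w, v).
     (v, - (weak_deriv ^^ 4) w + l2_scale (of_real (\<gamma> - \<eta>\<^sup>2)) ((weak_deriv ^^ 2) w)))"

definition A_dom :: "real \<Rightarrow> real \<Rightarrow> real \<Rightarrow> (L2 \<times> L2) set" where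
  "A_dom \<eta> \<kappa> \<gamma> = {(w, v). (w, v) \<in> X_space \<and>
     w \<in> sobolev 4 \<inter> sobolev0 2 \<and> v \<in> sobolev0 2 \<and>
     point_value ((weak_deriv ^^ 2) w) 0 = 0 \<and>
     point_value ((weak_deriv ^^ 2) w) 1 + of_real \<kappa> * point_value (weak_deriv v) 1 = 0 \<and>
     point_value ((weak_deriv ^^ 3) w) 1 - of_real (\<gamma> - \<eta>\<^sup>2) * point_value (weak_deriv w) 1 = 0}"

definition B_op :: "real \<Rightarrow> real \<Rightarrow> L2 \<times> L2 \<Rightarrow> L2 \<times> L2" where
  "B_op \<beta> \<eta> = (\<lambda>(w, v). (0, l2_scale (of_real (- 2 * \<beta> * \<eta>)) (weak_deriv v)))"

definition B_dom :: "(L2 \<times> L2) set" where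
  "B_dom = sobolev0 2 \<times> sobolev0 1"

lemma A_dom_subset_B_dom: "A_dom \<eta> \<kappa> \<gamma> \<subseteq> B_dom"
  by (auto simp: A_dom_def B_dom_def X_space_def sobolev0_def numeral_2_eq_2)

definition T_op :: "real \<Rightarrow> real \<Rightarrow> real \<Rightarrow> L2 \<times> L2 \<Rightarrow> L2 \<times> L2" where
  "T_op \<beta> \<eta> \<gamma> x = A_op \<eta> \<gamma> x + B_op \<beta> \<eta> x"

definition T_dom :: "real \<Rightarrow> real \<Rightarrow> real \<Rightarrow> (L2 \<times> L2) set" where
  "T_dom \<eta> \<kappa> \<gamma> = A_dom \<eta> \<kappa> \<gamma>"

definition T_spectrum :: "real \<Rightarrow> real \<Rightarrow> real \<Rightarrow> real \<Rightarrow> complex set" where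
  "T_spectrum \<beta> \<eta> \<kappa> \<gamma> =
     spectrum X_scale (X_norm \<eta> \<gamma>) X_space (T_dom \<eta> \<kappa> \<gamma>) (T_op \<beta> \<eta> \<gamma>)"

end

theory Submission
  imports Defs "HOL-Computational_Algebra.Fundamental_Theorem_Algebra"
begin

text \<open>The resolvent equation \<open>(\<lambda> - T)(w, v) = (f, g)\<close> reduces, with \<open>v = \<lambda>w - f\<close>, to a boundary value
  problem for a fourth-order equation with constant coefficients and right-hand side in
  \<open>L\<^sub>2(0,1)\<close>. It is solved explicitly through the roots of the characteristic polynomial; the two
  free initial values are then fixed by the conditions at \<open>1\<close>, so the problem is uniquely
  solvable with bounded solution operator as soon as the homogeneous problem has only the trivial
  solution. Hence the spectrum consists of the \<open>\<lambda>\<close> for which the homogeneous problem, whose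
  solutions are classical, has a nontrivial solution. Conjugation of solutions gives the symmetry.
  The dissipativity of \<open>T\<close> excludes \<open>Re \<lambda> > 0\<close>; if \<open>\<eta>, \<kappa> > 0\<close> and \<open>Re \<lambda> = 0\<close>, \<open>\<lambda> \<noteq> 0\<close>, the
  boundary dissipation forces \<open>w\<close> and its first three derivatives to vanish at \<open>1\<close>, so \<open>w = 0\<close>.\<close>

section \<open>Square-integrable functions on the unit interval\<close>

text \<open>The data of the resolvent equation are classes in \<open>L2\<close>, while the boundary
  conditions need point values up to the third derivative. The bridge is \<open>prim f g\<close>: on
  [0,1] f is an indefinite integral of the square-integrable g. Sobolev classes are replaced by
  chains of such functions, and uniqueness of weak derivatives and of continuous representatives
  makes the replacement faithful. The definition of the spectrum asks for a bounded inverse, so the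
  existence statements for the differential equation carry a constant chosen before the data. Its
  size is irrelevant, which permits crude bounds. With \<alpha> = \<gamma> - \<eta>^2 the reduced
  equation is w'''' = F + \<alpha>w'' - 2\<beta>\<eta>\<lambda>w' - \<lambda>^2 w, where F = g +
  \<lambda>f + 2\<beta>\<eta>f', and the moment condition becomes w''(1) + \<kappa>\<lambda>w'(1) =
  \<kappa>f'(1). The point value f'(1) is the reason for a trace estimate in the norm of X. The
  energy argument has \<lambda>w as multiplier and is void at \<lambda> = 0, where w itself takes
  its place.\<close>

lemma finite_measure_unit_ivl: "finite_measure unit_ivl"
  by (rule finite_measure_lebesgue_on) simp

lemma measure_unit_ivl [simp]: "measure unit_ivl {0<..<1} = 1"
  by (simp add: measure_restrict_space)

lemma integrable_const_unit_ivl [simp]: "integrable unit_ivl (\<lambda>s. c)"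
  by (rule finite_measure.integrable_const[OF finite_measure_unit_ivl])

lemma sq_int_integrable:
  assumes "square_integrable f"
  shows "integrable unit_ivl f"
proof (rule Bochner_Integration.integrable_bound)
  show "integrable unit_ivl (\<lambda>s. 1 + (cmod (f s))\<^sup>2)"
    using assms by (auto simp: square_integrable_def)
  show "f \<in> borel_measurable unit_ivl"
    using assms by (simp add: square_integrable_def)
  have "cmod (f s) \<le> 1 + (cmod (f s))\<^sup>2" for s
    using sum_squares_bound[of "cmod (f s)" 1] norm_ge_zero[of "f s"] unfolding power2_eq_square by linarith
  then show "AE s in unit_ivl. norm (f s) \<le> norm (1 + (cmod (f s))\<^sup>2)"
    by (auto simp: abs_of_nonneg)
qed

lemma absint_iff_integrable_unit_ivl:
  fixes f :: "real \<Rightarrow> 'a::euclidean_space"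
  shows "f absolutely_integrable_on {0..1} \<longleftrightarrow> integrable unit_ivl f"
  unfolding absolutely_integrable_on_Icc_iff_Ioo
  by (simp add: set_integrable_def integrable_restrict_space)

lemma LINT_unit_ivl_eq_integral:
  fixes f :: "real \<Rightarrow> 'a::euclidean_space"
  assumes "integrable unit_ivl f"
  shows "(LINT s|unit_ivl. f s) = integral {0..1} f"
  using lebesgue_integral_eq_integral[OF assms] by (simp add: integral_open_interval_real)

lemma sq_int_abs_int: "square_integrable f \<Longrightarrow> f absolutely_integrable_on {0..1}"
  by (simp add: absint_iff_integrable_unit_ivl sq_int_integrable)

lemma sq_int_subinterval:
  assumes "square_integrable f" "0 \<le> a" "b \<le> 1"
  shows "f absolutely_integrable_on {a..b}" "f integrable_on {a..b}"
proof -
  show "f absolutely_integrable_on {a..b}"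
    by (rule absolutely_integrable_on_subinterval[OF sq_int_abs_int[OF assms(1)]]) (use assms in auto)
  then show "f integrable_on {a..b}"
    by (rule set_lebesgue_integral_eq_integral)
qed

lemma continuous_imp_measurable_unit_ivl:
  fixes f :: "real \<Rightarrow> 'a::euclidean_space"
  assumes "continuous_on {0..1} f"
  shows "f \<in> borel_measurable unit_ivl"
  by (rule continuous_imp_measurable_on_sets_lebesgue)
     (auto intro: continuous_on_subset[OF assms])

lemma continuous_imp_integrable_unit_ivl:
  fixes f :: "real \<Rightarrow> 'a::euclidean_space"
  assumes "continuous_on {0..1} f"
  shows "integrable unit_ivl f"
  using absolutely_integrable_continuous_real[OF assms] by (simp add: absint_iff_integrable_unit_ivl)

lemma sq_int_mult_continuous_integrable:
  assumes g: "square_integrable g" and c: "continuous_on {0..1} \<phi>"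
  shows "integrable unit_ivl (\<lambda>s. g s * \<phi> s)"
proof -
  have "bounded (\<phi> ` {0..1})"
    by (intro compact_imp_bounded compact_continuous_image c) auto
  then have "(\<lambda>s. \<phi> s * g s) absolutely_integrable_on {0..1}"
    by (intro absolutely_integrable_bounded_measurable_product[OF bilinear_conv_bounded_bilinear[THEN iffD2, OF bounded_bilinear_mult]] sq_int_abs_int g)
       (auto intro!: continuous_imp_measurable_on_sets_lebesgue c)
  then show ?thesis by (simp add: mult.commute absint_iff_integrable_unit_ivl)
qed

lemma sq_int_continuous:
  assumes "continuous_on {0..1} f"
  shows "square_integrable f"
  unfolding square_integrable_def
  by (intro conjI continuous_imp_measurable_unit_ivl continuous_imp_integrable_unit_ivl
        continuous_intros assms)

section \<open>The norm of L2(0,1) on functions and its estimates\<close>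

definition l2n :: "(real \<Rightarrow> complex) \<Rightarrow> real" where
  "l2n f = sqrt (LINT s|unit_ivl. (cmod (f s))\<^sup>2)"

lemma l2n_nonneg [simp]: "0 \<le> l2n f"
  by (simp add: l2n_def)

lemma l2n_sq: "(l2n f)\<^sup>2 = (LINT s|unit_ivl. (cmod (f s))\<^sup>2)"
  by (simp add: l2n_def)

lemma l2n_le_sup:
  assumes f: "square_integrable f" and M: "\<And>s. s \<in> {0..1} \<Longrightarrow> cmod (f s) \<le> M"
  shows "l2n f \<le> M"
proof -
  have M0: "0 \<le> M" using order_trans[OF norm_ge_zero M[of 0]] by simp
  have "(LINT s|unit_ivl. (cmod (f s))\<^sup>2) \<le> (LINT s|unit_ivl. M\<^sup>2)"
    by (rule integral_mono) (use f M in \<open>auto simp: square_integrable_def intro!: power_mono\<close>)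
  then show ?thesis
    using M0 unfolding l2n_def by (simp add: real_le_lsqrt)
qed

text \<open>The interval has measure one, so this is nonnegativity of the variance of |f|, with
  \<open>m\<close> as the mean.\<close>

lemma LINT_cmod_le_l2n:
  assumes f: "square_integrable f"
  shows "(LINT s|unit_ivl. cmod (f s)) \<le> l2n f"
proof -
  define m where "m = (LINT s|unit_ivl. cmod (f s))"
  have i1: "integrable unit_ivl (\<lambda>s. cmod (f s))" using sq_int_integrable[OF f] by simp
  have i2: "integrable unit_ivl (\<lambda>s. (cmod (f s))\<^sup>2)" using f by (simp add: square_integrable_def)
  have "0 \<le> (LINT s|unit_ivl. (cmod (f s) - m)\<^sup>2)" by simp
  also have "\<dots> = (LINT s|unit_ivl. ((cmod (f s))\<^sup>2 - (2*m) * cmod (f s)) + m\<^sup>2)"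
    by (simp add: power2_diff algebra_simps)
  also have "\<dots> = (LINT s|unit_ivl. (cmod (f s))\<^sup>2) - (2*m) * m + m\<^sup>2"
    using i1 i2 by (subst Bochner_Integration.integral_add Bochner_Integration.integral_diff; simp add: m_def)+
  finally have "m\<^sup>2 \<le> (LINT s|unit_ivl. (cmod (f s))\<^sup>2)" by (simp add: power2_eq_square)
  then show ?thesis unfolding l2n_def m_def[symmetric] by (rule real_le_rsqrt)
qed

text \<open>The factor 2 comes from |a + b|^2 <= 2|a|^2 + 2|b|^2 and spares the Cauchy-Schwarz
  inequality; boundedness of the resolvent is insensitive to it.\<close>

lemma l2n_add:
  assumes f: "square_integrable f" and g: "square_integrable g"
  shows "l2n (\<lambda>s. f s + g s) \<le> 2 * (l2n f + l2n g)"
proof -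
  have i: "integrable unit_ivl (\<lambda>s. (cmod (f s))\<^sup>2)" "integrable unit_ivl (\<lambda>s. (cmod (g s))\<^sup>2)"
    "integrable unit_ivl (\<lambda>s. (cmod (f s + g s))\<^sup>2)"
    using f g square_integrable_add[OF f g] by (auto simp: square_integrable_def)
  have *: "(cmod (f s + g s))\<^sup>2 \<le> 2 * (cmod (f s))\<^sup>2 + 2 * (cmod (g s))\<^sup>2" for s
  proof -
    have "(cmod (f s + g s))\<^sup>2 \<le> (cmod (f s) + cmod (g s))\<^sup>2"
      by (intro power_mono norm_triangle_ineq) auto
    also have "\<dots> \<le> 2 * (cmod (f s))\<^sup>2 + 2 * (cmod (g s))\<^sup>2"
      using sum_squares_bound[of "cmod (f s)" "cmod (g s)"] by (simp add: power2_sum)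
    finally show ?thesis .
  qed
  have "(l2n (\<lambda>s. f s + g s))\<^sup>2 \<le> (LINT s|unit_ivl. 2 * (cmod (f s))\<^sup>2 + 2 * (cmod (g s))\<^sup>2)"
    unfolding l2n_sq by (rule integral_mono) (use i * in auto)
  also have "\<dots> = 2 * (l2n f)\<^sup>2 + 2 * (l2n g)\<^sup>2"
    using i by (simp add: l2n_sq)
  also have "\<dots> \<le> (2 * (l2n f + l2n g))\<^sup>2"
    using l2n_nonneg[of f] l2n_nonneg[of g] by (simp add: power2_eq_square algebra_simps)
  finally show ?thesis
    by (rule power2_le_imp_le) simp
qed

lemma l2n_scale: "l2n (\<lambda>s. c * f s) = cmod c * l2n f"
  by (simp add: l2n_def norm_mult power_mult_distrib real_sqrt_mult)

lemma l2n_const: "l2n (\<lambda>s. c) = cmod c"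
  by (simp add: l2n_def)

lemma cmod_integral_le_l2n:
  assumes f: "square_integrable f" and s: "0 \<le> a" "a \<le> b" "b \<le> 1"
  shows "cmod (integral {a..b} f) \<le> l2n f"
proof -
  have "cmod (integral {a..b} f) \<le> integral {a..b} (\<lambda>t. cmod (f t))"
    using sq_int_subinterval[OF f, of a b] s
    by (intro integral_norm_bound_integral) (auto simp: absolutely_integrable_on_def)
  also have "\<dots> \<le> integral {0..1} (\<lambda>t. cmod (f t))"
    by (intro integral_subset_le) (use sq_int_subinterval[OF f] s in \<open>auto simp: absolutely_integrable_on_def\<close>)
  also have "\<dots> = (LINT s|unit_ivl. cmod (f s))"
    using sq_int_integrable[OF f] by (simp add: LINT_unit_ivl_eq_integral)
  also have "\<dots> \<le> l2n f" by (rule LINT_cmod_le_l2n[OF f])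
  finally show ?thesis .
qed

section \<open>Indefinite integrals\<close>

text \<open>This encodes H^1: f is the absolutely continuous representative and g its derivative.
  Values of f outside [0,1] stay free, and g counts only up to a null set
  (\<open>prim_cong\<close>).\<close>

definition prim :: "(real \<Rightarrow> complex) \<Rightarrow> (real \<Rightarrow> complex) \<Rightarrow> bool" where
  "prim f g \<longleftrightarrow> square_integrable g \<and> (\<forall>s\<in>{0..1}. f s = f 0 + integral {0..s} g)"

lemma primD: "prim f g \<Longrightarrow> square_integrable g"
  "prim f g \<Longrightarrow> 0 \<le> s \<Longrightarrow> s \<le> 1 \<Longrightarrow> f s = f 0 + integral {0..s} g"
  unfolding prim_def by (blast, metis atLeastAtMost_iff)

lemma prim_eq: "prim f g \<Longrightarrow> s \<in> {0..1} \<Longrightarrow> f 0 + integral {0..s} g = f s"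
  by (rule primD(2)[symmetric]) auto

lemma prim_diff:
  assumes "prim f g" "0 \<le> a" "a \<le> b" "b \<le> 1"
  shows "f b - f a = integral {a..b} g"
proof -
  have "integral {0..a} g + integral {a..b} g = integral {0..b} g"
    by (rule Henstock_Kurzweil_Integration.integral_combine)
       (use sq_int_subinterval[of g 0 b] assms primD(1) in auto)
  moreover have "f a = f 0 + integral {0..a} g" "f b = f 0 + integral {0..b} g"
    by (rule primD(2)[OF assms(1)]; use assms in simp)+
  ultimately show ?thesis by (simp add: algebra_simps)
qed

lemma prim_continuous:
  assumes "prim f g" shows "continuous_on {0..1} f"
proof -
  have "continuous_on {0..1} (\<lambda>s. f 0 + integral {0..s} g)"
    using sq_int_subinterval(2)[OF primD(1)[OF assms], of 0 1]
    by (intro continuous_intros indefinite_integral_continuous_1) auto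
  then show ?thesis
    by (rule continuous_on_eq) (rule prim_eq[OF assms])
qed

lemma prim_sq_int: "prim f g \<Longrightarrow> square_integrable f"
  by (rule sq_int_continuous[OF prim_continuous])

lemma prim_add:
  assumes "prim f g" "prim f' g'"
  shows "prim (\<lambda>s. f s + f' s) (\<lambda>s. g s + g' s)"
  unfolding prim_def
proof (intro conjI ballI)
  show "square_integrable (\<lambda>s. g s + g' s)"
    by (rule square_integrable_add[OF primD(1)[OF assms(1)] primD(1)[OF assms(2)]])
  fix s :: real assume s: "s \<in> {0..1}"
  have *: "integral {0..s} (\<lambda>s. g s + g' s) = integral {0..s} g + integral {0..s} g'"
    by (intro Henstock_Kurzweil_Integration.integral_add sq_int_subinterval primD(1)[OF assms(1)] primD(1)[OF assms(2)])
       (use s in auto)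
  then show "f s + f' s = f 0 + f' 0 + integral {0..s} (\<lambda>s. g s + g' s)"
  proof -
    have "f s = f 0 + integral {0..s} g" "f' s = f' 0 + integral {0..s} g'"
      using s by (intro primD(2)[OF assms(1)] primD(2)[OF assms(2)]; simp)+
    then show ?thesis using * by (simp only: add.assoc add.left_commute)
  qed
qed

lemma prim_scale:
  assumes "prim f g"
  shows "prim (\<lambda>s. c * f s) (\<lambda>s. c * g s)"
  unfolding prim_def
proof (intro conjI ballI)
  show "square_integrable (\<lambda>s. c * g s)" by (rule square_integrable_scale[OF primD(1)[OF assms]])
  fix s :: real assume "s \<in> {0..1}"
  then have "f s = f 0 + integral {0..s} g" by (intro primD(2)[OF assms]) auto
  then show "c * f s = c * f 0 + integral {0..s} (\<lambda>s. c * g s)"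
    by (simp only: integral_mult_right distrib_left)
qed

lemma prim_const: "prim (\<lambda>s. c) (\<lambda>s. 0)"
  by (simp add: prim_def square_integrable_zero)

lemma prim_cong:
  assumes "prim f g" "square_integrable g'" "AE s in unit_ivl. g s = g' s"
    "\<And>s. s \<in> {0..1} \<Longrightarrow> f s = f' s"
  shows "prim f' g'"
  unfolding prim_def
proof (intro conjI ballI)
  fix s :: real assume s: "s \<in> {0..1}"
  have "AE s in lebesgue. s \<in> {0<..<1} \<longrightarrow> g s = g' s"
    using assms(3) by (simp add: AE_restrict_space_iff)
  then obtain N where N: "negligible N" "\<And>s. s \<notin> N \<Longrightarrow> s \<in> {0<..<1} \<Longrightarrow> g s = g' s"
    unfolding eventually_ae_filter_negligible by blast
  have "integral {0..s} g = integral {0..s} g'"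
    \<comment> \<open>The a.e. statement concerns the open interval, so the two end points join the
      exceptional set.\<close>
    by (rule integral_spike[of "N \<union> {0,1}"]) (use N s in auto)
  then show "f' s = f' 0 + integral {0..s} g'"
    using primD(2)[OF assms(1), of s] assms(4)[of s] assms(4)[of 0] s by (metis atLeastAtMost_iff order_refl zero_le_one)
qed (use assms in auto)

lemma prim_has_vector_derivative:
  assumes "prim f g" "continuous_on {0..1} g" "s \<in> {0..1}"
  shows "(f has_vector_derivative g s) (at s within {0..1})"
proof -
  have "((\<lambda>s. f 0 + integral {0..s} g) has_vector_derivative g s) (at s within {0..1})"
    using integral_has_vector_derivative[OF assms(2,3)]
    by (auto intro!: derivative_eq_intros)
  then show ?thesis
    by (rule has_vector_derivative_transform[rotated 2])
       (rule assms(3), rule prim_eq[OF assms(1), symmetric], assumption)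
qed

lemma has_vector_derivative_imp_prim:
  assumes "\<And>s. s \<in> {0..1} \<Longrightarrow> (f has_vector_derivative g s) (at s within {0..1})" "continuous_on {0..1} g"
  shows "prim f g"
  unfolding prim_def
proof (intro conjI ballI)
  show "square_integrable g" using assms sq_int_continuous by blast
  fix s :: real assume s: "s \<in> {0..1}"
  have "(g has_integral f s - f 0) {0..s}"
    by (rule fundamental_theorem_of_calculus)
       (use s in \<open>auto intro!: has_vector_derivative_within_subset[OF assms(1), of _ "{0..s}"]\<close>)
  then show "f s = f 0 + integral {0..s} g" by (simp add: integral_unique)
qed

text \<open>The defect of the identity has increments of order \<open>\<bar>t - s\<bar> \<bar>G t - G s\<bar>\<close> with \<open>G\<close> the
  continuous indefinite integral of \<open>\<bar>g\<bar>\<close>, so its derivative vanishes everywhere. This replaces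
  the usual appeal to Fubini's theorem.\<close>

lemma prim_integration_by_parts:
  fixes \<phi> \<phi>' :: "real \<Rightarrow> complex"
  assumes fg: "prim f g"
    and d: "\<And>s. s \<in> {0..1} \<Longrightarrow> (\<phi> has_vector_derivative \<phi>' s) (at s within {0..1})"
    and c: "continuous_on {0..1} \<phi>'"
  shows "integral {0..1} (\<lambda>s. g s * \<phi> s) + integral {0..1} (\<lambda>s. f s * \<phi>' s) = f 1 * \<phi> 1 - f 0 * \<phi> 0"
proof -
  have g: "square_integrable g" using fg primD(1) by auto
  have pp: "prim \<phi> \<phi>'" by (rule has_vector_derivative_imp_prim[OF d c])
  have cp: "continuous_on {0..1} \<phi>" by (rule prim_continuous[OF pp])
  have cf: "continuous_on {0..1} f" by (rule prim_continuous[OF fg])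
  define k where "k s = g s * \<phi> s + f s * \<phi>' s" for s
  have i1: "(\<lambda>s. g s * \<phi> s) absolutely_integrable_on {0..1}"
    using sq_int_mult_continuous_integrable[OF g cp] by (simp add: absint_iff_integrable_unit_ivl)
  have i2: "(\<lambda>s. f s * \<phi>' s) absolutely_integrable_on {0..1}"
    by (intro absolutely_integrable_continuous_real continuous_intros cf c)
  have ik: "k absolutely_integrable_on {0..1}"
    unfolding k_def by (intro set_integral_add i1 i2)
  have iks: "k integrable_on {a..b}" "(\<lambda>s. g s * \<phi> s) integrable_on {a..b}" "(\<lambda>s. f s * \<phi>' s) integrable_on {a..b}" if "0 \<le> a" "b \<le> 1" for a b
    using absolutely_integrable_on_subinterval[OF ik, of a b] absolutely_integrable_on_subinterval[OF i1, of a b]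
      absolutely_integrable_on_subinterval[OF i2, of a b] that
    by (simp_all add: absolutely_integrable_on_def)
  \<comment> \<open>\<open>H\<close> is the defect of the product rule. As g is merely integrable,
    \<open>f s * \<phi> s\<close> cannot be differentiated pointwise, but the increments of
    \<open>H\<close> are of second order.\<close>
  define H where "H s = integral {0..s} k - f s * \<phi> s" for s
  define G where "G s = integral {0..s} (\<lambda>t. cmod (g t))" for s
  have ng: "(\<lambda>t. cmod (g t)) integrable_on {a..b}" if "0 \<le> a" "b \<le> 1" for a b
    using sq_int_subinterval(1)[OF g that] by (auto simp: absolutely_integrable_on_def)
  have cG: "continuous_on {0..1} G"
    unfolding G_def by (intro indefinite_integral_continuous_1 ng) auto
  have "bounded (\<phi>' ` {0..1})"
    by (intro compact_imp_bounded compact_continuous_image c) auto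
  then obtain L where L: "\<And>s. s \<in> {0..1} \<Longrightarrow> cmod (\<phi>' s) \<le> L" unfolding bounded_iff by blast
  have L0: "0 \<le> L" using order_trans[OF norm_ge_zero L[of 0]] by simp
  have Gd: "G t - G s = integral {s..t} (\<lambda>t. cmod (g t))" if "0 \<le> s" "s \<le> t" "t \<le> 1" for s t
    using Henstock_Kurzweil_Integration.integral_combine[of 0 s t "\<lambda>t. cmod (g t)"] ng[of 0 t] that
    by (simp add: G_def algebra_simps)
  have fd: "cmod (f t - f s) \<le> G t - G s" if "0 \<le> s" "s \<le> t" "t \<le> 1" for s t
    unfolding Gd[OF that] prim_diff[OF fg that]
    using sq_int_subinterval(2)[OF g, of s t] ng[of s t] that by (intro integral_norm_bound_integral) auto
  have pd: "cmod (\<phi> t - \<phi> s) \<le> L * (t - s)" if "0 \<le> s" "s \<le> t" "t \<le> 1" for s t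
  proof -
    have "cmod (integral {s..t} \<phi>') \<le> L * (t - s)"
      using that L by (intro integral_bound continuous_on_subset[OF c]) auto
    then show ?thesis using prim_diff[OF pp that] by simp
  qed
  have key: "cmod (H t - H s) \<le> 2 * L * (t - s) * (G t - G s)" if st: "0 \<le> s" "s \<le> t" "t \<le> 1" for s t
  proof -
    have "integral {0..t} k - integral {0..s} k = integral {s..t} k"
      using Henstock_Kurzweil_Integration.integral_combine[of 0 s t k] iks(1)[of 0 t] st by (simp add: algebra_simps)
    also have "\<dots> = integral {s..t} (\<lambda>x. g x * \<phi> x) + integral {s..t} (\<lambda>x. f x * \<phi>' x)"
      unfolding k_def using iks(2,3)[of s t] st by (intro Henstock_Kurzweil_Integration.integral_add) auto
    finally have e1: "integral {0..t} k - integral {0..s} k = integral {s..t} (\<lambda>x. g x * \<phi> x) + integral {s..t} (\<lambda>x. f x * \<phi>' x)" .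
    \<comment> \<open>The increment of the product is split with \<phi> frozen at t and f frozen at
      s. Subtracting it leaves only the differences \<phi> x - \<phi> t and f x - f s under the
      integrals.\<close>
    have e2: "f t * \<phi> t - f s * \<phi> s = integral {s..t} (\<lambda>x. g x * \<phi> t) + integral {s..t} (\<lambda>x. f s * \<phi>' x)"
      unfolding integral_mult_left integral_mult_right prim_diff[OF fg st, symmetric] prim_diff[OF pp st, symmetric]
      by (simp add: algebra_simps)
    have j1: "(\<lambda>x. g x * \<phi> t) integrable_on {s..t}"
      using sq_int_subinterval(2)[OF g, of s t] st by (intro integrable_on_mult_left) auto
    have j2: "(\<lambda>x. f s * \<phi>' x) integrable_on {s..t}"
      using sq_int_subinterval(2)[OF primD(1)[OF pp], of s t] st by (intro integrable_on_mult_right) auto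
    have d1: "integral {s..t} (\<lambda>x. g x * \<phi> x) - integral {s..t} (\<lambda>x. g x * \<phi> t) = integral {s..t} (\<lambda>x. g x * \<phi> x - g x * \<phi> t)"
      using j1 iks(2)[of s t] st by (intro Henstock_Kurzweil_Integration.integral_diff[symmetric]) auto
    have d2: "integral {s..t} (\<lambda>x. f x * \<phi>' x) - integral {s..t} (\<lambda>x. f s * \<phi>' x) = integral {s..t} (\<lambda>x. f x * \<phi>' x - f s * \<phi>' x)"
      using j2 iks(3)[of s t] st by (intro Henstock_Kurzweil_Integration.integral_diff[symmetric]) auto
    have eq: "H t - H s = integral {s..t} (\<lambda>x. g x * \<phi> x - g x * \<phi> t) + integral {s..t} (\<lambda>x. f x * \<phi>' x - f s * \<phi>' x)"
      unfolding H_def d1[symmetric] d2[symmetric] using e1 e2 by (simp add: algebra_simps)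
    have b1: "cmod (integral {s..t} (\<lambda>x. g x * \<phi> x - g x * \<phi> t)) \<le> integral {s..t} (\<lambda>x. cmod (g x) * (L * (t - s)))"
    proof (rule integral_norm_bound_integral)
      show "(\<lambda>x. g x * \<phi> x - g x * \<phi> t) integrable_on {s..t}"
        using j1 iks(2)[of s t] st by (intro Henstock_Kurzweil_Integration.integrable_diff) auto
      show "(\<lambda>x. cmod (g x) * (L * (t - s))) integrable_on {s..t}"
        using ng[of s t] st by (intro integrable_on_mult_left) auto
      fix x assume x: "x \<in> {s..t}"
      have "cmod (\<phi> t - \<phi> x) \<le> L * (t - x)" using pd[of x t] x st by auto
      also have "\<dots> \<le> L * (t - s)" using x L0 by (intro mult_left_mono) auto
      finally have "cmod (g x) * cmod (\<phi> x - \<phi> t) \<le> cmod (g x) * (L * (t - s))"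
        by (intro mult_left_mono) (auto simp: norm_minus_commute)
      then show "cmod (g x * \<phi> x - g x * \<phi> t) \<le> cmod (g x) * (L * (t - s))"
        by (simp add: norm_mult flip: right_diff_distrib)
    qed
    have b1': "\<dots> = (G t - G s) * (L * (t - s))" unfolding Gd[OF st] by (simp add: integral_mult_left)
    have b2: "cmod (integral {s..t} (\<lambda>x. f x * \<phi>' x - f s * \<phi>' x)) \<le> ((G t - G s) * L) * (t - s)"
    proof (rule integral_bound)
      show "continuous_on {s..t} (\<lambda>x. f x * \<phi>' x - f s * \<phi>' x)"
        using st by (intro continuous_intros continuous_on_subset[OF c] continuous_on_subset[OF cf]) auto
      fix x assume x: "x \<in> {s..t}"
      have a: "cmod (f x - f s) \<le> G x - G s" using fd[of s x] x st by auto
      have "G x \<le> G t" using order_trans[OF norm_ge_zero fd, of x t] x st by auto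
      then have "cmod (f x - f s) * cmod (\<phi>' x) \<le> (G t - G s) * L"
        using a L[of x] x st order_trans[OF norm_ge_zero a] by (intro mult_mono) auto
      then show "cmod (f x * \<phi>' x - f s * \<phi>' x) \<le> (G t - G s) * L"
        by (simp add: norm_mult flip: left_diff_distrib)
    qed (use st in auto)
    show ?thesis unfolding eq
      using norm_triangle_ineq[of "integral {s..t} (\<lambda>x. g x * \<phi> x - g x * \<phi> t)" "integral {s..t} (\<lambda>x. f x * \<phi>' x - f s * \<phi>' x)"] b1 b1' b2
      by (simp add: algebra_simps)
  qed
  have key': "cmod (H t - H s) \<le> 2 * L * \<bar>t - s\<bar> * \<bar>G t - G s\<bar>" if "s \<in> {0..1}" "t \<in> {0..1}" for s t
  proof (cases "s \<le> t")
    case True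
    have "0 \<le> G t - G s" using order_trans[OF norm_ge_zero fd, of s t] True that by auto
    then show ?thesis using key[of s t] that True by auto
  next
    case False
    have "0 \<le> G s - G t" using order_trans[OF norm_ge_zero fd, of t s] False that by auto
    then show ?thesis using key[of t s] that False by (auto simp: norm_minus_commute)
  qed
  have Hd: "(H has_vector_derivative 0) (at s within {0..1})" if s: "s \<in> {0..1}" for s
    unfolding has_vector_derivative_def has_derivative_within_alt2
  proof (intro conjI allI impI)
    \<comment> \<open>The tolerance for \<open>G\<close> is e / (2L + 1); the summand 1 keeps the
      denominator positive when L = 0.\<close>
    fix e :: real assume e: "0 < e"
    have "\<forall>\<^sub>F t in at s within {0..1}. dist (G t) (G s) < e / (2 * L + 1)"
      using cG s e L0 unfolding continuous_on_def tendsto_iff by auto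
    then show "\<forall>\<^sub>F y in at s within {0..1}. norm (H y - H s - (y - s) *\<^sub>R 0) \<le> e * norm (y - s)"
      unfolding eventually_at_filter
    proof eventually_elim
      case (elim t)
      show ?case
      proof (intro impI)
        assume t: "t \<noteq> s" "t \<in> {0..1}"
        have "\<bar>G t - G s\<bar> \<le> e / (2 * L + 1)" using elim t by (auto simp: dist_real_def)
        then have "2 * L * \<bar>G t - G s\<bar> \<le> 2 * L * (e / (2 * L + 1))" using L0 by (intro mult_left_mono) auto
        also have "\<dots> \<le> e" using L0 e by (auto simp: field_simps)
        finally have "\<bar>t - s\<bar> * (2 * L * \<bar>G t - G s\<bar>) \<le> \<bar>t - s\<bar> * e" by (intro mult_left_mono) auto
        then show "norm (H t - H s - (t - s) *\<^sub>R 0) \<le> e * norm (t - s)"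
          using key'[OF s t(2)] by (simp add: algebra_simps)
      qed
    qed
  qed auto
  have "\<exists>c. \<forall>s\<in>{0..1}. H s = c"
    using has_vector_derivative_zero_constant[OF _ Hd] by (metis convex_real_interval(5))
  then have "H 1 = H 0" by auto
  then have "integral {0..1} k = f 1 * \<phi> 1 - f 0 * \<phi> 0" by (simp add: H_def algebra_simps)
  moreover have "integral {0..1} k = integral {0..1} (\<lambda>s. g s * \<phi> s) + integral {0..1} (\<lambda>s. f s * \<phi>' s)"
    unfolding k_def using iks(2,3)[of 0 1] by (intro Henstock_Kurzweil_Integration.integral_add) auto
  ultimately show ?thesis by simp
qed

section \<open>Weak derivatives are indefinite integrals\<close>

lemma sq_int_minus:
  assumes "square_integrable f" "square_integrable g"
  shows "square_integrable (\<lambda>s. f s - g s)"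
  using square_integrable_add[OF assms(1) square_integrable_scale[OF assms(2), of "-1"]] by simp

lemma sq_int_lebesgue_differentiation:
  assumes "square_integrable f"
  shows "AE x in unit_ivl. ((\<lambda>h. integral {x..x+h} f /\<^sub>R h) \<longlongrightarrow> f x) (at_right 0)"
proof -
  \<comment> \<open>Extension by zero, since the differentiation theorem asks for integrability on
    every bounded interval of the line. Over short intervals starting in (0,1) the averages of f and
    g coincide.\<close>
  define g where "g s = (if s \<in> {0..1} then f s else 0)" for s
  have "f integrable_on {0..1} \<inter> cbox a b" for a b
    unfolding cbox_interval Int_atLeastAtMost by (rule sq_int_subinterval(2)[OF assms]) auto
  then have "g integrable_on cbox a b" for a b
    unfolding g_def[abs_def] integrable_restrict_Int .
  from integrable_ccontinuous_explicit[of g, OF this]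
  obtain N where N: "negligible N" and lim:
    "\<And>x e. \<lbrakk>x \<notin> N; 0 < e\<rbrakk> \<Longrightarrow> \<exists>d>0. \<forall>h. 0 < h \<and> h < d \<longrightarrow>
        norm (integral (cbox x (x + h *\<^sub>R One)) g /\<^sub>R h ^ DIM(real) - g x) < e"
    by metis
  have "((\<lambda>h. integral {x..x+h} f /\<^sub>R h) \<longlongrightarrow> f x) (at_right 0)" if x: "x \<in> {0<..<1}" "x \<notin> N" for x
  proof (rule tendstoI)
    fix e :: real assume "0 < e"
    then obtain d where d: "0 < d" "\<And>h. 0 < h \<Longrightarrow> h < d \<Longrightarrow> norm (integral {x..x+h} g /\<^sub>R h - g x) < e"
      using lim[OF x(2)] by fastforce
    have "dist (integral {x..x+h} f /\<^sub>R h) (f x) < e" if h: "0 < h" "h < min d (1 - x)" for h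
    proof -
      have "integral {x..x+h} f = integral {x..x+h} g"
        by (rule Henstock_Kurzweil_Integration.integral_cong) (use h x in \<open>auto simp: g_def\<close>)
      then show ?thesis using d(2)[of h] h x by (auto simp: g_def dist_norm)
    qed
    then show "\<forall>\<^sub>F h in at_right 0. dist (integral {x..x+h} f /\<^sub>R h) (f x) < e"
      using d(1) x unfolding eventually_at_right_field by (intro exI[of _ "min d (1-x)"]) auto
  qed
  then have "AE x in lebesgue. x \<in> {0<..<1} \<longrightarrow> ((\<lambda>h. integral {x..x+h} f /\<^sub>R h) \<longlongrightarrow> f x) (at_right 0)"
    unfolding eventually_ae_filter_negligible using N by blast
  then show ?thesis by (simp add: AE_restrict_space_iff)
qed

section \<open>Trapezoidal test functions\<close>

lemma DERIV_max_0_sq: "((\<lambda>x::real. (max 0 x)\<^sup>2 / 2) has_real_derivative max 0 x) (at x)"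
proof -
  consider "x < 0" | "x = 0" | "0 < x" by linarith
  then show ?thesis
  proof cases
    case 1
    have "((\<lambda>x::real. 0) has_real_derivative 0) (at x)" by auto
    then have "((\<lambda>x::real. (max 0 x)\<^sup>2 / 2) has_real_derivative 0) (at x)"
      by (rule has_field_derivative_transform_within_open[of _ _ _ "{..<0}"]) (use 1 in auto)
    then show ?thesis using 1 by simp
  next
    case 2
    \<comment> \<open>At the corner the absolute value of the difference quotient is squeezed
      between 0 and |h|.\<close>
    have "((\<lambda>h::real. ((max 0 (0 + h))\<^sup>2 / 2 - (max 0 0)\<^sup>2 / 2) / h) \<longlongrightarrow> 0) (at 0)"
    proof (rule tendsto_rabs_zero_cancel, rule tendsto_sandwich[where f="\<lambda>_. 0" and h="\<lambda>h. \<bar>h\<bar>"])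
      show "\<forall>\<^sub>F h in at 0. \<bar>((max 0 (0 + h))\<^sup>2 / 2 - (max 0 0)\<^sup>2 / 2) / h\<bar> \<le> \<bar>h::real\<bar>"
        by (intro always_eventually allI) (auto simp: max_def power2_eq_square)
      show "((\<lambda>h::real. \<bar>h\<bar>) \<longlongrightarrow> 0) (at 0)" by (auto intro!: tendsto_eq_intros)
    qed auto
    then show ?thesis using 2 by (simp add: DERIV_def)
  next
    case 3
    have "((\<lambda>x::real. x\<^sup>2 / 2) has_real_derivative x) (at x)" by (auto intro!: derivative_eq_intros)
    then have "((\<lambda>x::real. (max 0 x)\<^sup>2 / 2) has_real_derivative x) (at x)"
      by (rule has_field_derivative_transform_within_open[of _ _ _ "{0<..}"]) (use 3 in auto)
    then show ?thesis using 3 by simp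
  qed
qed

text \<open>A combination of four ramps: for 0 < d <= h/2 it rises from 0 to 1 on [0,d], stays at 1
  up to h - d and is back at 0 from h on. As d shrinks it tends to the indicator of (0,h).\<close>

definition trapezoid :: "real \<Rightarrow> real \<Rightarrow> real \<Rightarrow> real" where
  "trapezoid h d x = (max 0 x - max 0 (x - d) - max 0 (x - h + d) + max 0 (x - h)) / d"

definition trapezoid_prim :: "real \<Rightarrow> real \<Rightarrow> real \<Rightarrow> real" where
  "trapezoid_prim h d x =
     ((max 0 x)\<^sup>2 / 2 - (max 0 (x - d))\<^sup>2 / 2 - (max 0 (x - h + d))\<^sup>2 / 2 + (max 0 (x - h))\<^sup>2 / 2) / d"

lemma DERIV_trapezoid_prim:
  "(trapezoid_prim h d has_real_derivative trapezoid h d x) (at x)"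
proof -
  have *: "((\<lambda>x. (max 0 (x - k))\<^sup>2 / 2) has_real_derivative max 0 (x - k)) (at x)" for k x :: real
    using DERIV_shift[of "\<lambda>x. (max 0 x)\<^sup>2 / 2" "max 0 (x - k)" x "- k"] DERIV_max_0_sq[of "x - k"] by simp
  show ?thesis
    unfolding trapezoid_prim_def trapezoid_def
    using *[of 0 x] *[of d x] *[of "h - d" x] *[of h x]
    by (intro DERIV_cdivide DERIV_add DERIV_diff) (auto simp: algebra_simps)
qed

lemma trapezoid_eq_0: "0 < d \<Longrightarrow> 2 * d \<le> h \<Longrightarrow> x \<le> 0 \<or> h \<le> x \<Longrightarrow> trapezoid h d x = 0"
  by (auto simp: trapezoid_def max_def)

lemma trapezoid_eq_1: "0 < d \<Longrightarrow> d \<le> x \<Longrightarrow> x \<le> h - d \<Longrightarrow> trapezoid h d x = 1"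
  by (auto simp: trapezoid_def max_def)

lemma trapezoid_bound: "0 < d \<Longrightarrow> 2 * d \<le> h \<Longrightarrow> \<bar>trapezoid h d x\<bar> \<le> 1"
  by (auto simp: trapezoid_def max_def field_simps abs_le_iff)

lemma trapezoid_prim_left: "0 < d \<Longrightarrow> 2 * d \<le> h \<Longrightarrow> x \<le> 0 \<Longrightarrow> trapezoid_prim h d x = 0"
  by (auto simp: trapezoid_prim_def max_def)

lemma trapezoid_prim_right:
  assumes "0 < d" "2 * d \<le> h" "h \<le> x"
  shows "trapezoid_prim h d x = h - d"
proof -
  have "max 0 x = x" "max 0 (x - d) = x - d" "max 0 (x - h + d) = x - h + d" "max 0 (x - h) = x - h"
    using assms by auto
  then show ?thesis
    using assms unfolding trapezoid_prim_def by (simp add: field_simps power2_eq_square)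
qed

lemma continuous_on_trapezoid: "continuous_on UNIV (trapezoid h d)"
  unfolding trapezoid_def[abs_def] divide_inverse by (intro continuous_intros)

text \<open>To the right of its trapezoid each primitive is the constant h - d. Subtracting a
  translate cancels this constant, which is how the support becomes compact in (0,1).\<close>

lemma test_function_trapezoid:
  assumes "0 < d" "2 * d \<le> h" "0 < a" "a + h < 1" "0 < c" "c + h < 1"
  shows "test_function (\<lambda>s. trapezoid_prim h d (s - a) - trapezoid_prim h d (s - c))
     (\<lambda>s. trapezoid h d (s - a) - trapezoid h d (s - c))"
  unfolding test_function_def
proof (intro conjI allI)
  have *: "((\<lambda>s. trapezoid_prim h d (s - k)) has_real_derivative trapezoid h d (s - k)) (at s)" for s k
    using DERIV_shift[of "trapezoid_prim h d" "trapezoid h d (s - k)" s "- k"] DERIV_trapezoid_prim[of h d "s - k"] by simp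
  show "((\<lambda>s. trapezoid_prim h d (s - a) - trapezoid_prim h d (s - c)) has_real_derivative
         trapezoid h d (s - a) - trapezoid h d (s - c)) (at s)" for s
    by (intro DERIV_diff *)
  show "continuous_on UNIV (\<lambda>s. trapezoid h d (s - a) - trapezoid h d (s - c))"
    by (intro continuous_intros continuous_on_compose2[OF continuous_on_trapezoid]) auto
  have "trapezoid_prim h d (s - a) - trapezoid_prim h d (s - c) = 0"
    if "s \<notin> {min a c..max a c + h}" for s
    using assms that by (cases "s < min a c") (auto simp: trapezoid_prim_left trapezoid_prim_right)
  then show "\<exists>l r. 0 < l \<and> r < 1 \<and>
      (\<forall>s. s \<notin> {l..r} \<longrightarrow> trapezoid_prim h d (s - a) - trapezoid_prim h d (s - c) = 0)"
    using assms by (intro exI[of _ "min a c"] exI[of _ "max a c + h"]) auto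
qed

lemma trapezoid_LINT_tendsto:
  assumes e: "square_integrable e" and h: "0 < h" "0 < a" "a + h < 1"
  shows "(\<lambda>n. LINT s|unit_ivl. e s * of_real (trapezoid h (h / (real n + 2)) (s - a)))
           \<longlonglongrightarrow> integral {a..a+h} e"
proof -
  have e1: "integral {a..a+h} e = (LINT s|unit_ivl. e s * of_real (indicator {a<..<a+h} s))"
  proof -
    have "integrable unit_ivl (\<lambda>s. e s * of_real (indicator {a<..<a+h} s))"
    proof (rule Bochner_Integration.integrable_bound[OF sq_int_integrable[OF e]])
      have [measurable]: "e \<in> borel_measurable unit_ivl" using e by (simp add: square_integrable_def)
      have "(indicator {a<..<a+h} :: real \<Rightarrow> real) \<in> borel_measurable unit_ivl"
        by (intro measurable_restrict_space1 borel_measurable_indicator) auto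
      then show "(\<lambda>s. e s * of_real (indicator {a<..<a+h} s)) \<in> borel_measurable unit_ivl"
        by measurable
      show "AE s in unit_ivl. cmod (e s * of_real (indicator {a<..<a+h} s)) \<le> cmod (e s)"
        by (intro AE_I2) (auto simp: norm_mult indicator_def)
    qed
    then have "(LINT s|unit_ivl. e s * of_real (indicator {a<..<a+h} s)) =
        integral {0..1} (\<lambda>s. e s * of_real (indicator {a<..<a+h} s))"
      by (rule LINT_unit_ivl_eq_integral)
    also have "\<dots> = integral {0..1} (\<lambda>s. if s \<in> {a<..<a+h} then e s else 0)"
      by (rule arg_cong[where f="integral {0..1}"]) (auto simp: indicator_def)
    also have "\<dots> = integral ({0..1} \<inter> {a<..<a+h}) e"
      by (simp only: integral_restrict_Int Int_commute)
    also have "{0..1} \<inter> {a<..<a+h} = {a<..<a+h}" using h by auto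
    finally show ?thesis by (simp add: integral_open_interval_real)
  qed
  show ?thesis unfolding e1
  proof (rule integral_dominated_convergence[where w="\<lambda>s. cmod (e s)"])
    show "integrable unit_ivl (\<lambda>s. cmod (e s))" using sq_int_integrable[OF e] by simp
    have [measurable]: "e \<in> borel_measurable unit_ivl" using e by (simp add: square_integrable_def)
    have "(indicator {a<..<a+h} :: real \<Rightarrow> real) \<in> borel_measurable unit_ivl"
      by (intro measurable_restrict_space1 borel_measurable_indicator) auto
    then show "(\<lambda>s. e s * of_real (indicator {a<..<a+h} s)) \<in> borel_measurable unit_ivl"
      by measurable
    show "(\<lambda>s. e s * of_real (trapezoid h (h / (real n + 2)) (s - a))) \<in> borel_measurable unit_ivl" for n
    proof -
      have "continuous_on {0..1} (\<lambda>s. trapezoid h (h / (real n + 2)) (s - a))"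
        by (intro continuous_on_compose2[OF continuous_on_trapezoid]) (auto intro!: continuous_intros)
      then have "(\<lambda>s. trapezoid h (h / (real n + 2)) (s - a)) \<in> borel_measurable unit_ivl"
        by (rule continuous_imp_measurable_unit_ivl)
      then show ?thesis by measurable
    qed
    \<comment> \<open>The offset 2 in h / (n + 2) gives 2d <= h already for n = 0, so the two slopes
      never overlap.\<close>
    have d: "0 < h / (real n + 2)" "2 * (h / (real n + 2)) \<le> h" for n
      using h by (auto simp: field_simps)
    show "AE s in unit_ivl. norm (e s * of_real (trapezoid h (h / (real n + 2)) (s - a))) \<le> cmod (e s)" for n
      using trapezoid_bound[OF d[of n]] by (intro AE_I2) (auto simp: norm_mult intro!: mult_left_le)
    have "(\<lambda>n. trapezoid h (h / (real n + 2)) (s - a)) \<longlonglongrightarrow> indicator {a<..<a+h} s" for s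
    proof (cases "s \<in> {a<..<a+h}")
      case True
      have "(\<lambda>n. h / (real n + 2)) \<longlonglongrightarrow> 0"
        using LIMSEQ_ignore_initial_segment[OF lim_const_over_n[of h], of 2] by (simp add: add.commute)
      then have "\<forall>\<^sub>F n in sequentially. h / (real n + 2) < min (s - a) (a + h - s)"
        by (rule order_tendstoD) (use True in auto)
      then have "\<forall>\<^sub>F n in sequentially. trapezoid h (h / (real n + 2)) (s - a) = 1"
        by eventually_elim (use d in \<open>auto intro!: trapezoid_eq_1\<close>)
      then show ?thesis using True by (simp add: tendsto_eventually)
    next
      case False
      then show ?thesis using trapezoid_eq_0[OF d, of "s - a"] by (auto simp: not_less)
    qed
    then show "AE s in unit_ivl. (\<lambda>n. e s * of_real (trapezoid h (h / (real n + 2)) (s - a)))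
        \<longlonglongrightarrow> e s * of_real (indicator {a<..<a+h} s)"
      by (intro AE_I2 tendsto_intros)
  qed
qed

text \<open>Testing with differences of translated trapezoids shows that the integral of \<open>e\<close> over an
  interval depends on its length only; Lebesgue's differentiation theorem does the rest.\<close>

lemma du_Bois_Reymond:
  assumes e: "square_integrable e"
    and z: "\<And>\<phi> \<phi>'. test_function \<phi> \<phi>' \<Longrightarrow> (LINT s|unit_ivl. e s * of_real (\<phi>' s)) = 0"
  shows "\<exists>k. AE s in unit_ivl. e s = k"
proof -
  have tr: "integral {a..a+h} e = integral {c..c+h} e"
    if h: "0 < h" "0 < a" "a + h < 1" "0 < c" "c + h < 1" for a c h
  proof (rule LIMSEQ_unique[OF trapezoid_LINT_tendsto[OF e h(1-3)]])
    have "(LINT s|unit_ivl. e s * of_real (trapezoid h (h / (real n + 2)) (s - c))) =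
        (LINT s|unit_ivl. e s * of_real (trapezoid h (h / (real n + 2)) (s - a)))" for n
    proof -
      have d: "0 < h / (real n + 2)" "2 * (h / (real n + 2)) \<le> h"
        using h by (auto simp: field_simps)
      have i: "integrable unit_ivl (\<lambda>s. e s * of_real (trapezoid h (h / (real n + 2)) (s - k)))" for k
        by (intro sq_int_mult_continuous_integrable e continuous_intros
              continuous_on_compose2[OF continuous_on_trapezoid]) auto
      show ?thesis
        using z[OF test_function_trapezoid[OF d h(2-5)]] i
        by (simp add: right_diff_distrib)
    qed
    then show "(\<lambda>n. LINT s|unit_ivl. e s * of_real (trapezoid h (h / (real n + 2)) (s - a)))
           \<longlonglongrightarrow> integral {c..c+h} e"
      using trapezoid_LINT_tendsto[OF e h(1) h(4-5)] by simp
  qed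
  define L where "L x \<longleftrightarrow> ((\<lambda>h. integral {x..x+h} e /\<^sub>R h) \<longlongrightarrow> e x) (at_right 0)" for x
  have ae: "AE x in unit_ivl. L x"
    using sq_int_lebesgue_differentiation[OF e] by (simp add: L_def)
  \<comment> \<open>Some point has averages converging to the value of e there, for otherwise (0,1)
    would be a null set. That value is the sought constant.\<close>
  have "\<exists>c\<in>{0<..<1}. L c"
  proof (rule ccontr)
    assume "\<not> ?thesis"
    then have "AE x in unit_ivl. x \<notin> {0<..<1}" using ae by (auto elim: eventually_mono)
    moreover have "AE x in unit_ivl. x \<in> {0<..<1}" by (intro AE_I2) auto
    ultimately have "AE x in unit_ivl. False" by eventually_elim blast
    then have "ae_filter unit_ivl = bot" by (simp add: trivial_limit_def)
    then have "measure unit_ivl (space unit_ivl) = 0" unfolding ae_filter_eq_bot_iff measure_def by simp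
    then show False by simp
  qed
  then obtain c where c: "c \<in> {0<..<1}" "L c" by blast
  have "AE x in unit_ivl. x \<in> {0<..<1}" by (intro AE_I2) auto
  then have "AE x in unit_ivl. e x = e c"
    using ae
  proof eventually_elim
    case (elim x)
    \<comment> \<open>Averages over intervals of equal length starting at x and at c agree, hence so
      do their limits e x and e c.\<close>
    have "\<forall>\<^sub>F h in at_right 0. integral {x..x+h} e /\<^sub>R h = integral {c..c+h} e /\<^sub>R h"
      unfolding eventually_at_right_field using elim(1) c(1)
      by (intro exI[of _ "min (1 - x) (1 - c)"]) (auto intro!: tr)
    from tendsto_cong[OF this] have "((\<lambda>h. integral {x..x+h} e /\<^sub>R h) \<longlongrightarrow> e c) (at_right 0)"
      using c(2) unfolding L_def by blast
    then show "e x = e c"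
      using elim(2) unfolding L_def by (intro tendsto_unique[of "at_right (0::real)"]) auto
  qed
  then show ?thesis by blast
qed

text \<open>Test functions vanish at 0 and 1, which removes the boundary terms from integration by
  parts.\<close>

lemma prim_weak:
  assumes fg: "prim f g" and t: "test_function \<phi> \<phi>'"
  shows "(LINT s|unit_ivl. f s * of_real (\<phi>' s)) = - (LINT s|unit_ivl. g s * of_real (\<phi> s))"
proof -
  have d: "(\<phi> has_real_derivative \<phi>' s) (at s)" and c: "continuous_on UNIV \<phi>'" for s
    using t by (auto simp: test_function_def)
  have c1: "continuous_on {0..1} (\<lambda>s. complex_of_real (\<phi>' s))"
    by (intro continuous_intros continuous_on_subset[OF c]) auto
  have c0: "continuous_on {0..1} (\<lambda>s. complex_of_real (\<phi> s))"
    by (intro continuous_intros continuous_at_imp_continuous_on ballI DERIV_isCont[OF d])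
  have v: "((\<lambda>s. complex_of_real (\<phi> s)) has_vector_derivative complex_of_real (\<phi>' s)) (at s within {0..1})" for s
    using d[of s] by (intro has_vector_derivative_of_real has_vector_derivative_at_within)
      (simp add: has_real_derivative_iff_has_vector_derivative)
  have z: "\<phi> 0 = 0" "\<phi> 1 = 0" using t by (force simp: test_function_def)+
  have "integral {0..1} (\<lambda>s. g s * of_real (\<phi> s)) + integral {0..1} (\<lambda>s. f s * of_real (\<phi>' s)) = 0"
    using prim_integration_by_parts[OF fg v c1] z by simp
  then show ?thesis
    using sq_int_mult_continuous_integrable[OF primD(1)[OF fg] c0]
      sq_int_mult_continuous_integrable[OF prim_sq_int[OF fg] c1]
    by (simp add: LINT_unit_ivl_eq_integral eq_neg_iff_add_eq_0 add.commute)
qed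

text \<open>Subtracting the indefinite integral of g leaves a function annihilated by the
  derivatives of all test functions, hence a constant. This is the converse of
  \<open>prim_weak\<close>.\<close>

lemma weak_imp_prim:
  assumes u: "square_integrable u" and g: "square_integrable g"
    and w: "\<And>\<phi> \<phi>'. test_function \<phi> \<phi>' \<Longrightarrow>
       (LINT s|unit_ivl. u s * of_real (\<phi>' s)) = - (LINT s|unit_ivl. g s * of_real (\<phi> s))"
  shows "\<exists>f. prim f g \<and> (AE s in unit_ivl. u s = f s)"
proof -
  define I where "I s = integral {0..s} g" for s
  have I: "prim I g" by (simp add: prim_def I_def g)
  have e: "square_integrable (\<lambda>s. u s - I s)" by (intro sq_int_minus u prim_sq_int[OF I])
  have orth: "(LINT s|unit_ivl. (u s - I s) * of_real (\<phi>' s)) = 0" if t: "test_function \<phi> \<phi>'" for \<phi> \<phi>'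
  proof -
    have "continuous_on UNIV \<phi>'" using t by (simp add: test_function_def)
    then have c: "continuous_on {0..1} (\<lambda>s. complex_of_real (\<phi>' s))"
      by (intro continuous_intros) (auto elim: continuous_on_subset)
    show ?thesis
      using w[OF t] prim_weak[OF I t] sq_int_mult_continuous_integrable[OF u c]
        sq_int_mult_continuous_integrable[OF prim_sq_int[OF I] c]
      by (simp add: left_diff_distrib)
  qed
  have "\<exists>k. AE s in unit_ivl. u s - I s = k"
    by (rule du_Bois_Reymond[OF e]) (rule orth)
  then obtain k where k: "AE s in unit_ivl. u s - I s = k" by blast
  show ?thesis
  proof (intro exI conjI)
    show "prim (\<lambda>s. k + I s) g" using prim_add[OF prim_const[of k] I] by simp
    show "AE s in unit_ivl. u s = k + I s"
      using k by eventually_elim (simp add: algebra_simps)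
  qed
qed

text \<open>Makes \<open>point_value\<close> well defined. The vanishing integral is one of a
  function continuous on the closed interval, so the end points are covered too.\<close>

lemma continuous_AE_eq:
  fixes f g :: "real \<Rightarrow> complex"
  assumes f: "continuous_on {0..1} f" and g: "continuous_on {0..1} g"
    and ae: "AE s in unit_ivl. f s = g s" and s: "s \<in> {0..1}"
  shows "f s = g s"
proof -
  have c: "continuous_on {0..1} (\<lambda>s. cmod (f s - g s))" by (intro continuous_intros f g)
  have "(LINT s|unit_ivl. cmod (f s - g s)) = (LINT s|unit_ivl. 0)"
  proof (rule integral_cong_AE)
    show "(\<lambda>s. cmod (f s - g s)) \<in> borel_measurable unit_ivl"
      by (rule continuous_imp_measurable_unit_ivl[OF c])
    show "AE s in unit_ivl. cmod (f s - g s) = 0" using ae by eventually_elim simp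
  qed simp
  then have "integral {0..1} (\<lambda>s. cmod (f s - g s)) = 0"
    using LINT_unit_ivl_eq_integral[OF continuous_imp_integrable_unit_ivl[OF c]] by simp
  then have "cmod (f s - g s) = 0"
    using integral_eq_0_iff[OF c] s by auto
  then show ?thesis by simp
qed

text \<open>At almost every point g and h are limits of the same right-sided difference quotients of
  f.\<close>

lemma prim_unique:
  assumes "prim f g" "prim f h"
  shows "AE s in unit_ivl. g s = h s"
proof -
  have "AE x in unit_ivl. x \<in> {0<..<1}" by (intro AE_I2) auto
  then show ?thesis
    using sq_int_lebesgue_differentiation[OF primD(1)[OF assms(1)]]
      sq_int_lebesgue_differentiation[OF primD(1)[OF assms(2)]]
  proof eventually_elim
    case (elim x)
    have "\<forall>\<^sub>F k in at_right 0. integral {x..x+k} g /\<^sub>R k = integral {x..x+k} h /\<^sub>R k"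
      unfolding eventually_at_right_field using elim(1)
      by (intro exI[of _ "1 - x"]) (auto simp flip: prim_diff[OF assms(1)] prim_diff[OF assms(2)])
    from tendsto_cong[OF this] have "((\<lambda>k. integral {x..x+k} g /\<^sub>R k) \<longlongrightarrow> h x) (at_right 0)"
      using elim(3) by blast
    then show "g x = h x"
      using elim(2) by (intro tendsto_unique[of "at_right (0::real)"]) auto
  qed
qed

section \<open>Classes in \<open>L2\<close> and their representatives\<close>

lemma l2_rel_refl: "l2_rel f f \<longleftrightarrow> square_integrable f"
  by (simp add: l2_rel_def)

lemma abs_L2_eq_iff:
  assumes "square_integrable f" "square_integrable g"
  shows "abs_L2 f = abs_L2 g \<longleftrightarrow> (AE s in unit_ivl. f s = g s)"
  using Quotient3_rel[OF Quotient3_L2, of f g] assms by (auto simp: l2_rel_def)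

lemma abs_L2_cases:
  obtains f where "square_integrable f" "u = abs_L2 f"
proof (rule that)
  show "square_integrable (rep_L2 u)"
    using Quotient3_rep_reflp[OF Quotient3_L2, of u] by (simp add: l2_rel_refl)
  show "u = abs_L2 (rep_L2 u)"
    using Quotient3_abs_rep[OF Quotient3_L2, of u] by simp
qed

lemma abs_L2_add:
  "square_integrable f \<Longrightarrow> square_integrable g \<Longrightarrow> abs_L2 f + abs_L2 g = abs_L2 (\<lambda>s. f s + g s)"
  by (intro plus_L2.abs_eq) (simp_all add: l2_rel_refl)

lemma abs_L2_scale: "square_integrable f \<Longrightarrow> l2_scale c (abs_L2 f) = abs_L2 (\<lambda>s. c * f s)"
  by (intro l2_scale.abs_eq) (simp_all add: l2_rel_refl)

lemma abs_L2_uminus: "square_integrable f \<Longrightarrow> - abs_L2 f = abs_L2 (\<lambda>s. - f s)"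
  by (intro uminus_L2.abs_eq) (simp_all add: l2_rel_refl)

lemma abs_L2_diff:
  "square_integrable f \<Longrightarrow> square_integrable g \<Longrightarrow> abs_L2 f - abs_L2 g = abs_L2 (\<lambda>s. f s - g s)"
  using abs_L2_add[of f "\<lambda>s. - g s"] square_integrable_scale[of g "-1"]
  by (simp add: minus_L2_def abs_L2_uminus)

lemma l2_inner_abs_L2_self:
  assumes "square_integrable f"
  shows "l2_inner (abs_L2 f) (abs_L2 f) = of_real ((l2n f)\<^sup>2)"
proof -
  have "l2_inner (abs_L2 f) (abs_L2 f) = (LINT s|unit_ivl. f s * cnj (f s))"
    using assms by (intro l2_inner.abs_eq) (simp_all add: l2_rel_refl)
  also have "\<dots> = (LINT s|unit_ivl. complex_of_real ((cmod (f s))\<^sup>2))"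
    by (simp only: complex_norm_square)
  also have "\<dots> = of_real ((l2n f)\<^sup>2)"
    unfolding l2n_sq by (rule integral_of_real) (use assms in \<open>simp add: square_integrable_def\<close>)
  finally show ?thesis .
qed

lemma has_weak_deriv_abs_L2:
  assumes "prim f g"
  shows "has_weak_deriv (abs_L2 f) (abs_L2 g)"
proof -
  have "l2_rel f f" "l2_rel g g"
    using primD(1)[OF assms] prim_sq_int[OF assms] by (auto simp: l2_rel_refl)
  from has_weak_deriv.abs_eq[OF this] show ?thesis using prim_weak[OF assms] by blast
qed

text \<open>The representative g is given in advance and f is matched to it. Applied from the
  highest derivative downwards, this turns a tower of weak derivatives into a chain of
  \<open>prim\<close> facts that share their functions.\<close>

lemma has_weak_derivE:
  assumes "has_weak_deriv u (abs_L2 g)" "square_integrable g"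
  obtains f where "u = abs_L2 f" "prim f g"
proof -
  obtain v where v: "square_integrable v" "u = abs_L2 v" by (rule abs_L2_cases)
  have "l2_rel v v" "l2_rel g g" using v assms by (auto simp: l2_rel_refl)
  from has_weak_deriv.abs_eq[OF this] assms(1)
  have "(LINT s|unit_ivl. v s * of_real (\<phi>' s)) = - (LINT s|unit_ivl. g s * of_real (\<phi> s))"
    if "test_function \<phi> \<phi>'" for \<phi> \<phi>' using that unfolding v(2) by blast
  from weak_imp_prim[OF v(1) assms(2) this] obtain f where f: "prim f g" "AE s in unit_ivl. v s = f s" by auto
  have "u = abs_L2 f" unfolding v(2) using f(2) abs_L2_eq_iff[OF v(1) prim_sq_int[OF f(1)]] by simp
  then show thesis using f(1) by (rule that)
qed

lemma has_weak_deriv_unique: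
  assumes "has_weak_deriv u v" "has_weak_deriv u w"
  shows "v = w"
proof -
  obtain g where g: "square_integrable g" "v = abs_L2 g" by (rule abs_L2_cases)
  obtain h where h: "square_integrable h" "w = abs_L2 h" by (rule abs_L2_cases)
  obtain f where f: "u = abs_L2 f" "prim f g" using has_weak_derivE assms(1) g by blast
  obtain f' where f': "u = abs_L2 f'" "prim f' h" using has_weak_derivE assms(2) h by blast
  have "AE s in unit_ivl. f' s = f s"
    using f(1) f'(1) abs_L2_eq_iff[OF prim_sq_int[OF f'(2)] prim_sq_int[OF f(2)]] by simp
  then have eq: "f' s = f s" if "s \<in> {0..1}" for s
    using continuous_AE_eq[OF prim_continuous[OF f'(2)] prim_continuous[OF f(2)]] that by blast
  have "prim f h" by (rule prim_cong[OF f'(2) h(1) _ eq]) auto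
  from prim_unique[OF f(2) this] show ?thesis
    using abs_L2_eq_iff[OF g(1) h(1)] g h by simp
qed

lemma weak_deriv_eq: "has_weak_deriv u g \<Longrightarrow> weak_deriv u = g"
  unfolding weak_deriv_def by (rule the_equality) (auto intro: has_weak_deriv_unique)

lemma weak_deriv_abs_L2: "prim f g \<Longrightarrow> weak_deriv (abs_L2 f) = abs_L2 g"
  by (intro weak_deriv_eq has_weak_deriv_abs_L2)

lemma point_value_abs_L2:
  assumes c: "continuous_on {0..1} f" and s: "s \<in> {0..1}"
  shows "point_value (abs_L2 f) s = f s"
proof -
  have r: "l2_rel f f" using sq_int_continuous[OF c] by (simp add: l2_rel_refl)
  note eq = has_continuous_rep.abs_eq[OF r]
  show ?thesis unfolding point_value_def eq
  proof (rule the_equality)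
    show "\<exists>g. (continuous_on {0..1} g \<and> (AE s in unit_ivl. f s = g s)) \<and> f s = g s"
      using c by (intro exI[of _ f]) auto
    fix d assume "\<exists>g. (continuous_on {0..1} g \<and> (AE s in unit_ivl. f s = g s)) \<and> d = g s"
    then show "d = f s" using continuous_AE_eq[OF c _ _ s] by metis
  qed
qed

section \<open>The fourth-order equation\<close>

text \<open>Since h is merely square integrable, variation of constants is applied after the
  substitution y = x + U with U the indefinite integral of h: the equation x' = r x + r U has
  continuous data and a classical solution. K depends on r alone and is fixed before y0 and
  h.\<close>

lemma solve_first_order:
  fixes r :: complex
  obtains K where "K \<ge> 0"
    "\<And>y0 h. square_integrable h \<Longrightarrow> \<exists>y. prim y (\<lambda>s. r * y s + h s) \<and> y 0 = y0 \<and>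
         (\<forall>s\<in>{0..1}. cmod (y s) \<le> K * (cmod y0 + l2n h))"
proof (rule that[of "exp (cmod r) * exp (cmod r) * cmod r + exp (cmod r) + 1"])
  \<comment> \<open>On [0,1] both e^(rs) and e^(-rs) are bounded by ?M, so |y| is at most ?M (|y0| +
    ?M |r| l2n h) + l2n h; the constant is a common bound for the coefficients.\<close>
  let ?M = "exp (cmod r)"
  show "0 \<le> ?M * ?M * cmod r + ?M + 1" by (intro add_nonneg_nonneg mult_nonneg_nonneg) auto
  fix y0 h assume h: "square_integrable h"
  define U where "U s = integral {0..s} h" for s
  have U: "prim U h" by (simp add: prim_def U_def h)
  have Ub: "cmod (U s) \<le> l2n h" if "s \<in> {0..1}" for s
    unfolding U_def by (rule cmod_integral_le_l2n[OF h]) (use that in auto)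
  define q where "q t = exp (- (r * of_real t)) * (r * U t)" for t
  have cq: "continuous_on {0..1} q"
    unfolding q_def by (intro continuous_intros prim_continuous[OF U])
  define Q where "Q s = integral {0..s} q" for s
  define x where "x s = exp (r * of_real s) * (y0 + Q s)" for s
  have E: "cmod (exp (c * of_real s)) \<le> ?M" if "cmod c = cmod r" "s \<in> {0..1}" for c and s :: real
  proof -
    have "cmod (exp (c * of_real s)) \<le> exp (cmod (c * of_real s))" by (rule norm_exp)
    also have "\<dots> \<le> ?M" using that mult_left_le[of "\<bar>s\<bar>" "cmod r"] by (simp add: norm_mult)
    finally show ?thesis .
  qed
  have Qb: "cmod (Q s) \<le> ?M * (cmod r * l2n h)" if s: "s \<in> {0..1}" for s
  proof -
    have "cmod (Q s) \<le> (?M * (cmod r * l2n h)) * (s - 0)"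
      unfolding Q_def
    proof (rule integral_bound)
      fix t assume "t \<in> {0..s}"
      then have t: "t \<in> {0..1}" using s by auto
      then show "cmod (q t) \<le> ?M * (cmod r * l2n h)"
        using E[of "- r" t] Ub[OF t] unfolding q_def norm_mult
        by (intro mult_mono) (auto intro!: mult_left_mono)
    qed (use s continuous_on_subset[OF cq] in auto)
    also have "\<dots> \<le> ?M * (cmod r * l2n h)"
      using s by (intro mult_left_le) auto
    finally show ?thesis .
  qed
  have dx: "(x has_vector_derivative r * x s + r * U s) (at s within {0..1})" if s: "s \<in> {0..1}" for s
  proof -
    have dQ: "(Q has_vector_derivative q s) (at s within {0..1})"
      unfolding Q_def[abs_def] by (rule integral_has_vector_derivative[OF cq s])
    have dE: "((\<lambda>s. exp (r * of_real s)) has_vector_derivative r * exp (r * of_real s)) (at s within {0..1})"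
      by (rule has_vector_derivative_real_field) (auto intro!: derivative_eq_intros)
    have "(x has_vector_derivative (exp (r * of_real s) * q s + r * exp (r * of_real s) * (y0 + Q s))) (at s within {0..1})"
      unfolding x_def[abs_def]
      by (rule has_vector_derivative_mult[OF dE, of "\<lambda>s. y0 + Q s" "q s", simplified])
         (use dQ in \<open>auto intro!: derivative_eq_intros\<close>)
    moreover have "exp (r * of_real s) * q s = r * U s"
      unfolding q_def by (simp add: exp_minus)
    ultimately show ?thesis unfolding x_def by (simp add: algebra_simps)
  qed
  have cx: "continuous_on {0..1} x"
    by (rule continuous_on_vector_derivative[OF dx])
  have px: "prim x (\<lambda>s. r * x s + r * U s)"
    by (rule has_vector_derivative_imp_prim[OF dx], assumption)
       (intro continuous_intros cx prim_continuous[OF U])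
  show "\<exists>y. prim y (\<lambda>s. r * y s + h s) \<and> y 0 = y0 \<and>
         (\<forall>s\<in>{0..1}. cmod (y s) \<le> (?M * ?M * cmod r + ?M + 1) * (cmod y0 + l2n h))"
  proof (intro exI conjI ballI)
    show "prim (\<lambda>s. x s + U s) (\<lambda>s. r * (x s + U s) + h s)"
      using prim_add[OF px U] by (simp add: algebra_simps)
    show "x 0 + U 0 = y0" by (simp add: x_def U_def Q_def)
    fix s :: real assume s: "s \<in> {0..1}"
    have "cmod (x s + U s) \<le> cmod (x s) + cmod (U s)" by (rule norm_triangle_ineq)
    also have "\<dots> \<le> ?M * (cmod y0 + ?M * (cmod r * l2n h)) + l2n h"
      unfolding x_def norm_mult
      using E[OF refl s] norm_triangle_le[OF add_mono[OF order_refl Qb[OF s]], of y0] Ub[OF s]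
      by (intro add_mono mult_mono) auto
    also have "\<dots> \<le> (?M * ?M * cmod r + ?M + 1) * (cmod y0 + l2n h)"
      by (simp add: algebra_simps add_nonneg_nonneg)
    finally show "cmod (x s + U s) \<le> (?M * ?M * cmod r + ?M + 1) * (cmod y0 + l2n h)" .
  qed
qed

text \<open>The roots of X^4 - \<alpha> X^2 + b X + m are split off one at a time. The second and
  third polynomial are the quotients by X - r1 and then X - r2 from Horner's scheme, and r4 follows
  from the vanishing cubic coefficient.\<close>

lemma quartic_roots:
  fixes \<alpha> b m :: complex
  obtains r1 r2 r3 r4 where "r1 + r2 + r3 + r4 = 0"
    "r1*r2 + r1*r3 + r1*r4 + r2*r3 + r2*r4 + r3*r4 = - \<alpha>"
    "r1*r2*r3 + r1*r2*r4 + r1*r3*r4 + r2*r3*r4 = - b" "r1*r2*r3*r4 = m"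
proof -
  have root: "\<exists>z. poly p z = 0" if "degree p > 0" for p :: "complex poly"
    using fundamental_theorem_of_algebra[of p] that by (auto simp: constant_degree)
  obtain r1 where r1: "poly [:m, b, -\<alpha>, 0, 1:] r1 = 0" using root[of "[:m, b, -\<alpha>, 0, 1:]"] by auto
  obtain r2 where r2: "poly [:r1^3 - \<alpha>*r1 + b, r1^2 - \<alpha>, r1, 1:] r2 = 0"
    using root[of "[:r1^3 - \<alpha>*r1 + b, r1^2 - \<alpha>, r1, 1:]"] by auto
  obtain r3 where r3: "poly [:r2^2 + r1*r2 + r1^2 - \<alpha>, r1 + r2, 1:] r3 = 0"
    using root[of "[:r2^2 + r1*r2 + r1^2 - \<alpha>, r1 + r2, 1:]"] by auto
  define r4 where "r4 = - (r1 + r2 + r3)"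
  have e3: "\<alpha> = r3^2 + (r1 + r2) * r3 + (r2^2 + r1*r2 + r1^2)"
    using r3 by (simp add: algebra_simps power2_eq_square)
  have e2: "b = - (r2^3 + r1*r2^2 + (r1^2 - \<alpha>)*r2 + r1^3 - \<alpha>*r1)"
    using r2 by (simp add: algebra_simps power2_eq_square power3_eq_cube eq_neg_iff_add_eq_0)
  have e1: "m = - (r1^4 - \<alpha>*r1^2 + b*r1)"
    using r1 by (simp add: algebra_simps power2_eq_square power4_eq_xxxx eq_neg_iff_add_eq_0)
  show thesis
  proof (rule that)
    show "r1 + r2 + r3 + r4 = 0" by (simp add: r4_def)
    show "r1*r2 + r1*r3 + r1*r4 + r2*r3 + r2*r4 + r3*r4 = - \<alpha>"
      unfolding e3 r4_def by algebra
    show "r1*r2*r3 + r1*r2*r4 + r1*r3*r4 + r2*r3*r4 = - b"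
      unfolding e2 e3 r4_def by algebra
    show "r1*r2*r3*r4 = m"
      unfolding e1 e2 e3 r4_def by algebra
  qed
qed

text \<open>First-order form of z'''' = F + \<alpha> z'' - b z' - m z, with z0 to z3 standing for z
  and its first three derivatives. For square-integrable F the last equation holds in the sense of
  indefinite integrals.\<close>

definition ode_sol ::
  "complex \<Rightarrow> complex \<Rightarrow> complex \<Rightarrow> (real \<Rightarrow> complex) \<Rightarrow> (real \<Rightarrow> complex) \<Rightarrow> (real \<Rightarrow> complex) \<Rightarrow>
   (real \<Rightarrow> complex) \<Rightarrow> (real \<Rightarrow> complex) \<Rightarrow> bool" where
  "ode_sol \<alpha> b m F z0 z1 z2 z3 \<longleftrightarrow> prim z0 z1 \<and> prim z1 z2 \<and> prim z2 z3 \<and>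
     prim z3 (\<lambda>s. F s + \<alpha> * z2 s - b * z1 s - m * z0 s)"

lemma ode_sol_lincomb:
  assumes "ode_sol \<alpha> b m F z0 z1 z2 z3" "ode_sol \<alpha> b m G w0 w1 w2 w3"
  shows "ode_sol \<alpha> b m (\<lambda>s. F s + c * G s) (\<lambda>s. z0 s + c * w0 s) (\<lambda>s. z1 s + c * w1 s)
     (\<lambda>s. z2 s + c * w2 s) (\<lambda>s. z3 s + c * w3 s)"
proof -
  have "prim (\<lambda>s. z3 s + c * w3 s)
      (\<lambda>s. (F s + \<alpha> * z2 s - b * z1 s - m * z0 s) + c * (G s + \<alpha> * w2 s - b * w1 s - m * w0 s))"
    using assms unfolding ode_sol_def by (intro prim_add prim_scale) auto
  moreover have "(\<lambda>s. (F s + \<alpha> * z2 s - b * z1 s - m * z0 s) + c * (G s + \<alpha> * w2 s - b * w1 s - m * w0 s)) =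
      (\<lambda>s. F s + c * G s + \<alpha> * (z2 s + c * w2 s) - b * (z1 s + c * w1 s) - m * (z0 s + c * w0 s))"
    by (auto simp: fun_eq_iff algebra_simps)
  ultimately show ?thesis
    using assms unfolding ode_sol_def by (auto intro!: prim_add prim_scale)
qed

text \<open>With \<open>r\<^sub>1, \<dots>, r\<^sub>4\<close> the characteristic roots, the equation is the chain of first-order
  equations \<open>(D - r\<^sub>4) z = y\<^sub>3\<close>, \<open>(D - r\<^sub>3) y\<^sub>3 = y\<^sub>2\<close>, \<open>(D - r\<^sub>2) y\<^sub>2 = y\<^sub>1\<close>, \<open>(D - r\<^sub>1) y\<^sub>1 = F\<close>.\<close>

lemma solve_initial_value_problem:
  fixes \<alpha> b m :: complex
  obtains K where "K \<ge> 0"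
    "\<And>a c F. square_integrable F \<Longrightarrow>
    \<exists>z0 z1 z2 z3. ode_sol \<alpha> b m F z0 z1 z2 z3 \<and> z0 0 = 0 \<and> z1 0 = a \<and> z2 0 = 0 \<and> z3 0 = c \<and>
       (\<forall>s\<in>{0..1}. \<forall>z\<in>{z0,z1,z2,z3}. cmod (z s) \<le> K * (cmod a + cmod c + l2n F))"
proof -
  obtain r1 r2 r3 r4 where r: "r1 + r2 + r3 + r4 = 0"
    "r1*r2 + r1*r3 + r1*r4 + r2*r3 + r2*r4 + r3*r4 = - \<alpha>"
    "r1*r2*r3 + r1*r2*r4 + r1*r3*r4 + r2*r3*r4 = - b" "r1*r2*r3*r4 = m"
    by (rule quartic_roots)
  obtain K1 where K1: "K1 \<ge> 0" "\<And>y0 h. square_integrable h \<Longrightarrow> \<exists>y. prim y (\<lambda>s. r1 * y s + h s) \<and> y 0 = y0 \<and>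
         (\<forall>s\<in>{0..1}. cmod (y s) \<le> K1 * (cmod y0 + l2n h))" by (rule solve_first_order[of r1]) (rule that; assumption)
  obtain K2 where K2: "K2 \<ge> 0" "\<And>y0 h. square_integrable h \<Longrightarrow> \<exists>y. prim y (\<lambda>s. r2 * y s + h s) \<and> y 0 = y0 \<and>
         (\<forall>s\<in>{0..1}. cmod (y s) \<le> K2 * (cmod y0 + l2n h))" by (rule solve_first_order[of r2]) (rule that; assumption)
  obtain K3 where K3: "K3 \<ge> 0" "\<And>y0 h. square_integrable h \<Longrightarrow> \<exists>y. prim y (\<lambda>s. r3 * y s + h s) \<and> y 0 = y0 \<and>
         (\<forall>s\<in>{0..1}. cmod (y s) \<le> K3 * (cmod y0 + l2n h))" by (rule solve_first_order[of r3]) (rule that; assumption)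
  obtain K4 where K4: "K4 \<ge> 0" "\<And>y0 h. square_integrable h \<Longrightarrow> \<exists>y. prim y (\<lambda>s. r4 * y s + h s) \<and> y 0 = y0 \<and>
         (\<forall>s\<in>{0..1}. cmod (y s) \<le> K4 * (cmod y0 + l2n h))" by (rule solve_first_order[of r4]) (rule that; assumption)
  \<comment> \<open>Coefficients of y3 and y2 in z''', obtained by differentiating z' = r4 z + y3
    twice along the chain. They are complete homogeneous symmetric polynomials of the roots.\<close>
  define k3 where "k3 = r4^2 + r3*r4 + r3^2"
  define k2 where "k2 = r2 + r3 + r4"
  \<comment> \<open>Relative to the size \<open>S\<close> of the data, \<open>C1\<close> and
    \<open>C2\<close> bound the initial values of y1 and y2, and \<open>B1\<close> to
    \<open>B4\<close> bound the solutions y1 to y4.\<close>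
  define C2 where "C2 = cmod (r3 + r4)"
  define C1 where "C1 = 1 + cmod k3 + cmod k2 * C2"
  define B1 where "B1 = K1 * (C1 + 1)"
  define B2 where "B2 = K2 * (C2 + B1)"
  define B3 where "B3 = K3 * (1 + B2)"
  define B4 where "B4 = K4 * B3"
  have C0: "0 \<le> C1" "0 \<le> C2" by (auto simp: C1_def C2_def)
  have B0: "0 \<le> B1" using K1(1) C0 by (auto simp: B1_def)
  have B0': "0 \<le> B2" using K2(1) C0 B0 by (auto simp: B2_def)
  have B0'': "0 \<le> B3" using K3(1) B0' by (auto simp: B3_def)
  have B0''': "0 \<le> B4" using K4(1) B0'' by (auto simp: B4_def)
  define K where "K = B4 + (cmod r4 * B4 + B3) + (cmod (r4^2) * B4 + cmod (r3 + r4) * B3 + B2)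
     + (cmod (r4^3) * B4 + cmod k3 * B3 + cmod k2 * B2 + B1)"
  have Kge: "B4 \<le> K" "cmod r4 * B4 + B3 \<le> K" "cmod (r4^2) * B4 + cmod (r3 + r4) * B3 + B2 \<le> K"
      "cmod (r4^3) * B4 + cmod k3 * B3 + cmod k2 * B2 + B1 \<le> K"
    unfolding K_def using B0 B0' B0'' B0''' by (simp_all add: add_nonneg_nonneg)
  show thesis
  proof (rule that[of K])
    show "0 \<le> K" using Kge(1) B0''' by simp
    fix a c F assume F: "square_integrable F"
    define S where "S = cmod a + cmod c + l2n F"
    have S: "0 \<le> S" "cmod a \<le> S" "cmod c \<le> S" "l2n F \<le> S" by (auto simp: S_def)
    \<comment> \<open>The initial values of y2 and y1 solve a triangular system: z(0) = 0 and z'(0)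
      = a give y4(0) = 0 and y3(0) = a, then z''(0) = 0 gives \<open>i2\<close> and z'''(0) = c
      gives \<open>i1\<close>.\<close>
    define i2 where "i2 = - (r3 + r4) * a"
    define i1 where "i1 = c - k3 * a - k2 * i2"
    have i2: "cmod i2 \<le> C2 * S"
      using S unfolding i2_def C2_def by (simp add: norm_mult mult_left_mono del: minus_add_distrib)
    have i1: "cmod i1 \<le> C1 * S"
    proof -
      have "cmod i1 \<le> cmod c + cmod k3 * cmod a + cmod k2 * cmod i2"
        unfolding i1_def
        using norm_triangle_ineq4[of "c - k3 * a" "k2 * i2"] norm_triangle_ineq4[of c "k3 * a"]
        by (simp add: norm_mult)
      also have "\<dots> \<le> S + cmod k3 * S + cmod k2 * (C2 * S)"
        using S i2 by (intro add_mono mult_left_mono) auto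
      finally show ?thesis by (simp add: C1_def algebra_simps)
    qed
    obtain y1 where y1: "prim y1 (\<lambda>s. r1 * y1 s + F s)" "y1 0 = i1"
        "\<And>s. s \<in> {0..1} \<Longrightarrow> cmod (y1 s) \<le> K1 * (cmod i1 + l2n F)"
      using K1(2)[OF F, of i1] by blast
    have b1: "cmod (y1 s) \<le> B1 * S" if "s \<in> {0..1}" for s
    proof -
      have "K1 * (cmod i1 + l2n F) \<le> K1 * (C1 * S + S)"
        using K1(1) i1 S by (intro mult_left_mono add_mono) auto
      then show ?thesis using y1(3)[OF that] by (simp add: B1_def algebra_simps)
    qed
    have n1: "l2n y1 \<le> B1 * S" by (rule l2n_le_sup[OF prim_sq_int[OF y1(1)] b1])
    obtain y2 where y2: "prim y2 (\<lambda>s. r2 * y2 s + y1 s)" "y2 0 = i2"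
        "\<And>s. s \<in> {0..1} \<Longrightarrow> cmod (y2 s) \<le> K2 * (cmod i2 + l2n y1)"
      using K2(2)[OF prim_sq_int[OF y1(1)], of i2] by blast
    have b2: "cmod (y2 s) \<le> B2 * S" if "s \<in> {0..1}" for s
    proof -
      have "K2 * (cmod i2 + l2n y1) \<le> K2 * (C2 * S + B1 * S)"
        using K2(1) i2 n1 by (intro mult_left_mono add_mono) auto
      then show ?thesis using y2(3)[OF that] by (simp add: B2_def algebra_simps)
    qed
    have n2: "l2n y2 \<le> B2 * S" by (rule l2n_le_sup[OF prim_sq_int[OF y2(1)] b2])
    obtain y3 where y3: "prim y3 (\<lambda>s. r3 * y3 s + y2 s)" "y3 0 = a"
        "\<And>s. s \<in> {0..1} \<Longrightarrow> cmod (y3 s) \<le> K3 * (cmod a + l2n y2)"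
      using K3(2)[OF prim_sq_int[OF y2(1)], of a] by blast
    have b3: "cmod (y3 s) \<le> B3 * S" if "s \<in> {0..1}" for s
    proof -
      have "K3 * (cmod a + l2n y2) \<le> K3 * (S + B2 * S)"
        using K3(1) S n2 by (intro mult_left_mono add_mono) auto
      then show ?thesis using y3(3)[OF that] by (simp add: B3_def algebra_simps)
    qed
    have n3: "l2n y3 \<le> B3 * S" by (rule l2n_le_sup[OF prim_sq_int[OF y3(1)] b3])
    obtain y4 where y4: "prim y4 (\<lambda>s. r4 * y4 s + y3 s)" "y4 0 = 0"
        "\<And>s. s \<in> {0..1} \<Longrightarrow> cmod (y4 s) \<le> K4 * (cmod 0 + l2n y3)"
      using K4(2)[OF prim_sq_int[OF y3(1)], of 0] by blast
    have b4: "cmod (y4 s) \<le> B4 * S" if "s \<in> {0..1}" for s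
    proof -
      have "K4 * (cmod 0 + l2n y3) \<le> K4 * (B3 * S)"
        using K4(1) n3 by (intro mult_left_mono) auto
      then show ?thesis using y4(3)[OF that] by (simp add: B4_def algebra_simps)
    qed
    define z1 where "z1 s = r4 * y4 s + y3 s" for s
    define z2 where "z2 s = r4^2 * y4 s + (r3 + r4) * y3 s + y2 s" for s
    define z3 where "z3 s = r4^3 * y4 s + k3 * y3 s + k2 * y2 s + y1 s" for s
    have p0: "prim y4 z1" using y4(1) by (simp add: z1_def[abs_def])
    have p1: "prim z1 z2"
    proof -
      have "prim z1 (\<lambda>s. r4 * (r4 * y4 s + y3 s) + (r3 * y3 s + y2 s))"
        unfolding z1_def[abs_def] by (intro prim_add prim_scale y4 y3)
      moreover have "(\<lambda>s. r4 * (r4 * y4 s + y3 s) + (r3 * y3 s + y2 s)) = z2"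
        by (auto simp: z2_def fun_eq_iff algebra_simps power2_eq_square)
      ultimately show ?thesis by simp
    qed
    have p2: "prim z2 z3"
    proof -
      have "prim z2 (\<lambda>s. r4^2 * (r4 * y4 s + y3 s) + (r3 + r4) * (r3 * y3 s + y2 s) + (r2 * y2 s + y1 s))"
        unfolding z2_def[abs_def] by (intro prim_add prim_scale y4 y3 y2)
      moreover have "(\<lambda>s. r4^2 * (r4 * y4 s + y3 s) + (r3 + r4) * (r3 * y3 s + y2 s) + (r2 * y2 s + y1 s)) = z3"
        by (auto simp: z3_def k3_def k2_def fun_eq_iff algebra_simps power2_eq_square power3_eq_cube)
      ultimately show ?thesis by simp
    qed
    have p3: "prim z3 (\<lambda>s. F s + \<alpha> * z2 s - b * z1 s - m * y4 s)"
    proof -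
      have "prim z3 (\<lambda>s. r4^3 * (r4 * y4 s + y3 s) + k3 * (r3 * y3 s + y2 s) + k2 * (r2 * y2 s + y1 s) + (r1 * y1 s + F s))"
        unfolding z3_def[abs_def] by (intro prim_add prim_scale y4 y3 y2 y1)
      \<comment> \<open>By Vieta's formulas the coefficients of y1, ..., y4 on the two sides
        agree.\<close>
      moreover have "r4^3 * (r4 * Y4 + Y3) + k3 * (r3 * Y3 + Y2) + k2 * (r2 * Y2 + Y1) + (r1 * Y1 + FF) =
          FF + \<alpha> * (r4^2 * Y4 + (r3 + r4) * Y3 + Y2) - b * (r4 * Y4 + Y3) - m * Y4" for Y1 Y2 Y3 Y4 FF
        using r unfolding k2_def k3_def by algebra
      ultimately show ?thesis by (simp add: z1_def z2_def)
    qed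
    show "\<exists>z0 z1 z2 z3. ode_sol \<alpha> b m F z0 z1 z2 z3 \<and> z0 0 = 0 \<and> z1 0 = a \<and> z2 0 = 0 \<and> z3 0 = c \<and>
       (\<forall>s\<in>{0..1}. \<forall>z\<in>{z0,z1,z2,z3}. cmod (z s) \<le> K * (cmod a + cmod c + l2n F))"
    proof (rule exI[of _ y4], rule exI[of _ z1], rule exI[of _ z2], rule exI[of _ z3], intro conjI ballI)
      show "ode_sol \<alpha> b m F y4 z1 z2 z3" unfolding ode_sol_def using p0 p1 p2 p3 by blast
      show "y4 0 = 0" "z1 0 = a" "z2 0 = 0" "z3 0 = c"
        unfolding z1_def z2_def z3_def y4(2) y3(2) y2(2) y1(2) i1_def i2_def by (simp_all add: algebra_simps)
      fix s z assume s: "s \<in> {0..(1::real)}" and z: "z \<in> {y4, z1, z2, z3}"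
      have q: "cmod (k * y s) \<le> cmod k * (B * S)" if "cmod (y s) \<le> B * S" for k B and y :: "real \<Rightarrow> complex"
        using that by (simp add: norm_mult mult_left_mono)
      have t': "cmod (z1 s) \<le> cmod r4 * (B4 * S) + B3 * S"
        "cmod (z2 s) \<le> cmod (r4^2) * (B4 * S) + cmod (r3 + r4) * (B3 * S) + B2 * S"
        "cmod (z3 s) \<le> cmod (r4^3) * (B4 * S) + cmod k3 * (B3 * S) + cmod k2 * (B2 * S) + B1 * S"
        unfolding z1_def z2_def z3_def
        by (intro s order_trans[OF norm_triangle_ineq] add_mono q b4 b3 b2 b1)+
      have t: "cmod (y4 s) \<le> B4 * S" "cmod (z1 s) \<le> (cmod r4 * B4 + B3) * S"
        "cmod (z2 s) \<le> (cmod (r4^2) * B4 + cmod (r3 + r4) * B3 + B2) * S"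
        "cmod (z3 s) \<le> (cmod (r4^3) * B4 + cmod k3 * B3 + cmod k2 * B2 + B1) * S"
        using t' b4[OF s] by (simp_all only: distrib_right mult.assoc)
      have "cmod (z s) \<le> K * S"
        using z t Kge[THEN mult_right_mono, OF S(1)] by (auto intro: order_trans)
      then show "cmod (z s) \<le> K * (cmod a + cmod c + l2n F)" by (simp add: S_def)
    qed
  qed
qed

section \<open>The two-point boundary value problem\<close>

lemma prim_zero:
  assumes "prim f g" "continuous_on {0..1} g" "\<And>s. s \<in> {0..1} \<Longrightarrow> f s = 0" "s \<in> {0..1}"
  shows "g s = 0"
proof -
  have "prim f (\<lambda>_. 0)"
    by (rule prim_cong[OF prim_const[of 0]]) (auto simp: assms square_integrable_zero)
  from prim_unique[OF assms(1) this] show ?thesis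
    using continuous_AE_eq[OF assms(2) continuous_on_const _ assms(4)] by blast
qed

text \<open>Plays the part of a nonvanishing determinant for the conditions at 1 without naming a
  fundamental system. For the operator b, m and p depend on the spectral parameter; at the origin
  all three are zero.\<close>

definition nondeg :: "complex \<Rightarrow> complex \<Rightarrow> complex \<Rightarrow> complex \<Rightarrow> bool" where
  "nondeg \<alpha> b m p \<longleftrightarrow> (\<forall>z0 z1 z2 z3. ode_sol \<alpha> b m (\<lambda>_. 0) z0 z1 z2 z3 \<and> z0 0 = 0 \<and> z2 0 = 0 \<and>
     z2 1 + p * z1 1 = 0 \<and> z3 1 - \<alpha> * z1 1 = 0 \<longrightarrow> (\<forall>s\<in>{0..1}. z0 s = 0))"

lemma ode_sol_zero:
  assumes z: "ode_sol \<alpha> b m F z0 z1 z2 z3" and z0: "\<And>s. s \<in> {0..1} \<Longrightarrow> z0 s = 0" and s: "s \<in> {0..1}"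
  shows "z1 s = 0" "z2 s = 0" "z3 s = 0"
proof -
  have p: "prim z0 z1" "prim z1 z2" "prim z2 z3" and c: "continuous_on {0..1} z1" "continuous_on {0..1} z2" "continuous_on {0..1} z3"
    using z by (auto simp: ode_sol_def intro: prim_continuous)
  have 1: "z1 s = 0" if "s \<in> {0..1}" for s by (rule prim_zero[OF p(1) c(1) z0 that])
  have 2: "z2 s = 0" if "s \<in> {0..1}" for s by (rule prim_zero[OF p(2) c(2) 1 that])
  have 3: "z3 s = 0" if "s \<in> {0..1}" for s by (rule prim_zero[OF p(3) c(3) 2 that])
  show "z1 s = 0" "z2 s = 0" "z3 s = 0" using 1 2 3 s by auto
qed

lemma singular_2x2:
  fixes a b c d :: complex
  assumes "a * d - b * c = 0"
  obtains x y where "x \<noteq> 0 \<or> y \<noteq> 0" "x * a + y * b = 0" "x * c + y * d = 0"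
proof -
  consider "b \<noteq> 0 \<or> a \<noteq> 0" | "a = 0" "b = 0" "d \<noteq> 0 \<or> c \<noteq> 0" | "a = 0" "b = 0" "c = 0" "d = 0" by blast
  then show thesis
  proof cases
    case 1 then show thesis using that[of b "-a"] assms by (auto simp: algebra_simps)
  next
    case 2 then show thesis using that[of d "-c"] by (auto simp: algebra_simps)
  next
    case 3 then show thesis using that[of 1 0] by auto
  qed
qed

text \<open>Two homogeneous solutions start from z'(0) = 1 and from z'''(0) = 1. A kernel vector of
  their boundary matrix at 1 would combine them to a nontrivial solution of the homogeneous problem,
  so the determinant is nonzero. Cramer's rule then corrects a particular solution, with
  coefficients bounded linearly by the data.\<close>

lemma solve_boundary_value_problem:
  assumes nd: "nondeg \<alpha> b m p"
  obtains K where "K \<ge> 0"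
    "\<And>F d. square_integrable F \<Longrightarrow>
    \<exists>w0 w1 w2 w3. ode_sol \<alpha> b m F w0 w1 w2 w3 \<and> w0 0 = 0 \<and> w2 0 = 0 \<and>
       w2 1 + p * w1 1 = d \<and> w3 1 - \<alpha> * w1 1 = 0 \<and>
       (\<forall>s\<in>{0..1}. \<forall>w\<in>{w0,w1,w2,w3}. cmod (w s) \<le> K * (l2n F + cmod d))"
proof -
  obtain K where K: "K \<ge> 0" "\<And>a c F. square_integrable F \<Longrightarrow>
    \<exists>z0 z1 z2 z3. ode_sol \<alpha> b m F z0 z1 z2 z3 \<and> z0 0 = 0 \<and> z1 0 = a \<and> z2 0 = 0 \<and> z3 0 = c \<and>
       (\<forall>s\<in>{0..1}. \<forall>z\<in>{z0,z1,z2,z3}. cmod (z s) \<le> K * (cmod a + cmod c + l2n F))"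
    by (rule solve_initial_value_problem[of \<alpha> b m]) (rule that; assumption)
  have l2n0: "l2n (\<lambda>_. 0) = 0" using l2n_const[of 0] by simp
  obtain f0 f1 f2 f3 where f: "ode_sol \<alpha> b m (\<lambda>_. 0) f0 f1 f2 f3" "f0 0 = 0" "f1 0 = 1" "f2 0 = 0" "f3 0 = 0"
      "\<forall>s\<in>{0..1}. \<forall>z\<in>{f0,f1,f2,f3}. cmod (z s) \<le> K"
    using K(2)[OF square_integrable_zero, of 1 0] l2n0 by auto
  obtain g0 g1 g2 g3 where g: "ode_sol \<alpha> b m (\<lambda>_. 0) g0 g1 g2 g3" "g0 0 = 0" "g1 0 = 0" "g2 0 = 0" "g3 0 = 1"
      "\<forall>s\<in>{0..1}. \<forall>z\<in>{g0,g1,g2,g3}. cmod (z s) \<le> K"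
    using K(2)[OF square_integrable_zero, of 0 1] l2n0 by auto
  \<comment> \<open>Boundary matrix: rows are the two conditions at 1, columns the two homogeneous
    solutions.\<close>
  define a11 a12 a21 a22 where a: "a11 = f2 1 + p * f1 1" "a12 = g2 1 + p * g1 1"
    "a21 = f3 1 - \<alpha> * f1 1" "a22 = g3 1 - \<alpha> * g1 1"
  define D where "D = a11 * a22 - a12 * a21"
  have D: "D \<noteq> 0"
  proof
    assume "D = 0"
    then obtain x y where xy: "x \<noteq> 0 \<or> y \<noteq> 0" "x * a11 + y * a12 = 0" "x * a21 + y * a22 = 0"
      using singular_2x2 unfolding D_def by blast
    have z: "ode_sol \<alpha> b m (\<lambda>_. 0) (\<lambda>s. 0 + x * f0 s + y * g0 s) (\<lambda>s. 0 + x * f1 s + y * g1 s)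
        (\<lambda>s. 0 + x * f2 s + y * g2 s) (\<lambda>s. 0 + x * f3 s + y * g3 s)"
    proof -
      have "ode_sol \<alpha> b m (\<lambda>_. 0) (\<lambda>_. 0) (\<lambda>_. 0) (\<lambda>_. 0) (\<lambda>_. 0)"
        using prim_const[of 0] by (simp add: ode_sol_def)
      from ode_sol_lincomb[OF ode_sol_lincomb[OF this f(1), of x] g(1), of y] show ?thesis by simp
    qed
    have z0: "0 + x * f0 s + y * g0 s = 0" if "s \<in> {0..1}" for s
    proof -
      have "0 + x * f0 0 + y * g0 0 = 0" "0 + x * f2 0 + y * g2 0 = 0"
        "(0 + x * f2 1 + y * g2 1) + p * (0 + x * f1 1 + y * g1 1) = 0"
        "(0 + x * f3 1 + y * g3 1) - \<alpha> * (0 + x * f1 1 + y * g1 1) = 0"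
        using xy(2,3) f g unfolding a by (simp_all add: algebra_simps)
      then show ?thesis using nd z that unfolding nondeg_def by blast
    qed
    \<comment> \<open>The combination is trivial, so its initial values z'(0) = x and z'''(0) = y
      vanish.\<close>
    have "x = 0" "y = 0"
      using ode_sol_zero(1)[OF z z0, of 0] ode_sol_zero(3)[OF z z0, of 0] f g by auto
    then show False using xy(1) by simp
  qed
  \<comment> \<open>\<open>L\<close> bounds both conditions at 1 for the particular solution
    relative to the data, the summand 1 inside \<open>M\<close> accounts for d, and the division by
    \<open>cmod D\<close> is that of Cramer's rule.\<close>
  define L where "L = K * (1 + cmod p + cmod \<alpha>)"
  define M where "M = (cmod a11 + cmod a12 + cmod a21 + cmod a22) / cmod D * (L + 1)"
  have L0: "0 \<le> L" unfolding L_def using K(1) by (simp add: add_nonneg_nonneg)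
  have M0: "0 \<le> M" unfolding M_def using L0 by (simp add: add_nonneg_nonneg)
  show thesis
  proof (rule that[of "K + M * K + M * K"])
    show "0 \<le> K + M * K + M * K" using K(1) M0 by simp
    fix F d assume F: "square_integrable F"
    define S where "S = l2n F + cmod d"
    have S: "0 \<le> S" "l2n F \<le> S" "cmod d \<le> S" by (auto simp: S_def)
    obtain z0 z1 z2 z3 where z: "ode_sol \<alpha> b m F z0 z1 z2 z3" "z0 0 = 0" "z1 0 = 0" "z2 0 = 0" "z3 0 = 0"
        "\<forall>s\<in>{0..1}. \<forall>z\<in>{z0,z1,z2,z3}. cmod (z s) \<le> K * l2n F"
      using K(2)[OF F, of 0 0] by auto
    have zb: "cmod (z s) \<le> K * S" if "s \<in> {0..1}" "z \<in> {z0,z1,z2,z3}" for z s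
      using z(6) that S K(1) by (meson mult_left_mono order_trans)
    \<comment> \<open>What the particular solution still lacks in the two conditions at 1.\<close>
    define u v where uv: "u = d - (z2 1 + p * z1 1)" "v = - (z3 1 - \<alpha> * z1 1)"
    have ub: "cmod u \<le> (L + 1) * S"
    proof -
      have "cmod u \<le> cmod d + (cmod (z2 1) + cmod p * cmod (z1 1))"
        unfolding uv by (intro order_trans[OF norm_triangle_ineq4] add_mono order_refl order_trans[OF norm_triangle_ineq]) (simp add: norm_mult)
      also have "\<dots> \<le> S + (K * S + cmod p * (K * S))"
        by (intro add_mono mult_left_mono zb S) auto
      also have "\<dots> \<le> (L + 1) * S"
        unfolding L_def using S K(1) by (simp add: algebra_simps)
      finally show ?thesis .
    qed
    have vb: "cmod v \<le> (L + 1) * S"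
    proof -
      have "cmod v \<le> cmod (z3 1) + cmod \<alpha> * cmod (z1 1)"
        unfolding uv norm_minus_cancel by (intro order_trans[OF norm_triangle_ineq4]) (simp add: norm_mult)
      also have "\<dots> \<le> K * S + cmod \<alpha> * (K * S)"
        by (intro add_mono mult_left_mono zb S) auto
      also have "\<dots> \<le> (L + 1) * S"
        unfolding L_def using S K(1) by (simp add: algebra_simps)
      finally show ?thesis .
    qed
    define x y where xy: "x = (u * a22 - a12 * v) / D" "y = (a11 * v - u * a21) / D"
    have eq1: "x * a11 + y * a12 = u"
    proof -
      have "x * a11 + y * a12 = u * D / D" unfolding xy D_def by (simp add: algebra_simps flip: add_divide_distrib diff_divide_distrib)
      then show ?thesis using D by simp
    qed
    have eq2: "x * a21 + y * a22 = v"
    proof -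
      have "x * a21 + y * a22 = v * D / D" unfolding xy D_def by (simp add: algebra_simps flip: add_divide_distrib diff_divide_distrib)
      then show ?thesis using D by simp
    qed
    have comb: "cmod (k * q - l * r) / cmod D \<le> M * S" if kq: "cmod k + cmod l \<le> cmod a11 + cmod a12 + cmod a21 + cmod a22"
        and "cmod q \<le> (L + 1) * S" "cmod r \<le> (L + 1) * S" for k l q r
    proof -
      have "cmod (k * q - l * r) \<le> cmod k * cmod q + cmod l * cmod r"
        by (intro order_trans[OF norm_triangle_ineq4]) (simp add: norm_mult)
      also have "\<dots> \<le> cmod k * ((L + 1) * S) + cmod l * ((L + 1) * S)"
        using that by (intro add_mono mult_left_mono) auto
      also have "\<dots> = (cmod k + cmod l) * ((L + 1) * S)" by (simp add: algebra_simps)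
      also have "\<dots> \<le> (cmod a11 + cmod a12 + cmod a21 + cmod a22) * ((L + 1) * S)"
        using kq S L0 by (intro mult_right_mono) auto
      finally have "cmod (k * q - l * r) / cmod D \<le> (cmod a11 + cmod a12 + cmod a21 + cmod a22) * ((L + 1) * S) / cmod D"
        by (rule divide_right_mono) auto
      then show ?thesis by (simp add: M_def)
    qed
    have xb: "cmod x \<le> M * S"
      using comb[of a22 a12 u v] ub vb by (simp add: xy norm_divide mult.commute)
    have yb: "cmod y \<le> M * S"
      using comb[of a11 a21 v u] ub vb by (simp add: xy norm_divide mult.commute)
    have sol: "ode_sol \<alpha> b m F (\<lambda>s. z0 s + x * f0 s + y * g0 s) (\<lambda>s. z1 s + x * f1 s + y * g1 s)
        (\<lambda>s. z2 s + x * f2 s + y * g2 s) (\<lambda>s. z3 s + x * f3 s + y * g3 s)"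
      using ode_sol_lincomb[OF ode_sol_lincomb[OF z(1) f(1), of x] g(1), of y] by simp
    have bd: "cmod (zz s + x * ff s + y * gg s) \<le> (K + M * K + M * K) * S"
      if s: "s \<in> {0..1}" and "zz \<in> {z0,z1,z2,z3}" "ff \<in> {f0,f1,f2,f3}" "gg \<in> {g0,g1,g2,g3}" for zz ff gg s
    proof -
      have b: "cmod (zz s) \<le> K * S" "cmod (ff s) \<le> K" "cmod (gg s) \<le> K"
        using zb f(6) g(6) that by blast+
      have "cmod (zz s + x * ff s + y * gg s) \<le> cmod (zz s) + cmod x * cmod (ff s) + cmod y * cmod (gg s)"
        using norm_triangle_ineq[of "zz s + x * ff s" "y * gg s"] norm_triangle_ineq[of "zz s" "x * ff s"]
        by (simp add: norm_mult)
      also have "\<dots> \<le> K * S + (M * S) * K + (M * S) * K"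
        using b xb yb M0 S by (intro add_mono mult_mono) auto
      finally show ?thesis by (simp add: algebra_simps)
    qed
    show "\<exists>w0 w1 w2 w3. ode_sol \<alpha> b m F w0 w1 w2 w3 \<and> w0 0 = 0 \<and> w2 0 = 0 \<and>
       w2 1 + p * w1 1 = d \<and> w3 1 - \<alpha> * w1 1 = 0 \<and>
       (\<forall>s\<in>{0..1}. \<forall>w\<in>{w0,w1,w2,w3}. cmod (w s) \<le> (K + M * K + M * K) * (l2n F + cmod d))"
    proof (rule exI, rule exI, rule exI, rule exI, intro conjI)
      show "ode_sol \<alpha> b m F (\<lambda>s. z0 s + x * f0 s + y * g0 s) (\<lambda>s. z1 s + x * f1 s + y * g1 s)
        (\<lambda>s. z2 s + x * f2 s + y * g2 s) (\<lambda>s. z3 s + x * f3 s + y * g3 s)" by (rule sol)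
      show "z0 0 + x * f0 0 + y * g0 0 = 0" "z2 0 + x * f2 0 + y * g2 0 = 0"
        using z f g by auto
      show "z2 1 + x * f2 1 + y * g2 1 + p * (z1 1 + x * f1 1 + y * g1 1) = d"
        using eq1 unfolding a uv by (simp add: algebra_simps)
      show "z3 1 + x * f3 1 + y * g3 1 - \<alpha> * (z1 1 + x * f1 1 + y * g1 1) = 0"
        using eq2 unfolding a uv by (simp add: algebra_simps)
      show "\<forall>s\<in>{0..1}. \<forall>w\<in>{\<lambda>s. z0 s + x * f0 s + y * g0 s, \<lambda>s. z1 s + x * f1 s + y * g1 s,
          \<lambda>s. z2 s + x * f2 s + y * g2 s, \<lambda>s. z3 s + x * f3 s + y * g3 s}.
          cmod (w s) \<le> (K + M * K + M * K) * (l2n F + cmod d)"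
        using bd by (simp add: S_def)
    qed
  qed
qed

section \<open>Uniqueness for the homogeneous boundary value problem\<close>

lemma sq_int_cnj:
  assumes "square_integrable f" shows "square_integrable (\<lambda>s. cnj (f s))"
proof -
  have [measurable]: "f \<in> borel_measurable unit_ivl" using assms by (simp add: square_integrable_def)
  have [measurable]: "cnj \<in> borel_measurable borel"
    by (intro borel_measurable_continuous_onI continuous_intros)
  show ?thesis using assms by (simp add: square_integrable_def)
qed

lemma prim_cnj:
  assumes "prim f g" shows "prim (\<lambda>s. cnj (f s)) (\<lambda>s. cnj (g s))"
  unfolding prim_def
proof (intro conjI ballI)
  show "square_integrable (\<lambda>s. cnj (g s))" by (rule sq_int_cnj[OF primD(1)[OF assms]])
  fix s :: real assume "s \<in> {0..1}"
  then have "f s = f 0 + integral {0..s} g" by (intro primD(2)[OF assms]) auto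
  then have "cnj (f s) = cnj (f 0) + cnj (integral {0..s} g)" by simp
  then show "cnj (f s) = cnj (f 0) + integral {0..s} (\<lambda>s. cnj (g s))"
    by (simp only: integral_cnj)
qed

text \<open>Conjugating a solution conjugates b, m and p and keeps the real \<alpha>. Since the
  operator has real coefficients, these are its parameters at the conjugate spectral value.\<close>

lemma nondeg_cnj:
  assumes "nondeg (of_real \<alpha>) b m p"
  shows "nondeg (of_real \<alpha>) (cnj b) (cnj m) (cnj p)"
  unfolding nondeg_def
proof (intro allI impI ballI, elim conjE)
  fix z0 z1 z2 z3 and s :: real
  assume z: "ode_sol (of_real \<alpha>) (cnj b) (cnj m) (\<lambda>_. 0) z0 z1 z2 z3" "z0 0 = 0" "z2 0 = 0"
    "z2 1 + cnj p * z1 1 = 0" "z3 1 - of_real \<alpha> * z1 1 = 0" and s: "s \<in> {0..1}"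
  have "ode_sol (of_real \<alpha>) b m (\<lambda>_. 0) (\<lambda>s. cnj (z0 s)) (\<lambda>s. cnj (z1 s)) (\<lambda>s. cnj (z2 s)) (\<lambda>s. cnj (z3 s))"
    using z(1) unfolding ode_sol_def by (auto dest: prim_cnj)
  moreover have "cnj (z0 0) = 0" "cnj (z2 0) = 0" using z by auto
  moreover have "cnj (z2 1) + p * cnj (z1 1) = 0"
    using arg_cong[OF z(4), of cnj] by simp
  moreover have "cnj (z3 1) - of_real \<alpha> * cnj (z1 1) = 0"
    using arg_cong[OF z(5), of cnj] by simp
  ultimately have "cnj (z0 s) = 0" using assms s unfolding nondeg_def by blast
  then show "z0 s = 0" by simp
qed

lemma ode_sol_homogeneous_derivs:
  assumes "ode_sol \<alpha> b m (\<lambda>_. 0) z0 z1 z2 z3"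
  shows "s \<in> {0..1} \<Longrightarrow> (z0 has_vector_derivative z1 s) (at s within {0..1})"
    and "s \<in> {0..1} \<Longrightarrow> (z1 has_vector_derivative z2 s) (at s within {0..1})"
    and "s \<in> {0..1} \<Longrightarrow> (z2 has_vector_derivative z3 s) (at s within {0..1})"
    and "s \<in> {0..1} \<Longrightarrow> (z3 has_vector_derivative (\<alpha> * z2 s - b * z1 s - m * z0 s)) (at s within {0..1})"
    and "continuous_on {0..1} z0" "continuous_on {0..1} z1" "continuous_on {0..1} z2" "continuous_on {0..1} z3"
proof -
  have p: "prim z0 z1" "prim z1 z2" "prim z2 z3" "prim z3 (\<lambda>s. \<alpha> * z2 s - b * z1 s - m * z0 s)"
    using assms by (auto simp: ode_sol_def)
  show c: "continuous_on {0..1} z0" "continuous_on {0..1} z1" "continuous_on {0..1} z2" "continuous_on {0..1} z3"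
    using p by (auto intro: prim_continuous)
  show "(z0 has_vector_derivative z1 s) (at s within {0..1})"
    "(z1 has_vector_derivative z2 s) (at s within {0..1})"
    "(z2 has_vector_derivative z3 s) (at s within {0..1})"
    "(z3 has_vector_derivative (\<alpha> * z2 s - b * z1 s - m * z0 s)) (at s within {0..1})"
    if "s \<in> {0..1}"
    using that c by (auto intro!: prim_has_vector_derivative p continuous_intros)
qed

text \<open>The common end of the energy arguments: the balance between the end points has the wrong
  sign for a density that is nonnegative, so the continuous density is zero.\<close>

lemma nonneg_derivative_vanishes:
  fixes q q' :: "real \<Rightarrow> complex"
  assumes d: "\<And>s. s \<in> {0..1} \<Longrightarrow> (q has_vector_derivative q' s) (at s within {0..1})"
    and c: "continuous_on {0..1} q'"
    and n: "\<And>s. s \<in> {0..1} \<Longrightarrow> 0 \<le> Re (q' s)" and e: "Re (q 1) \<le> Re (q 0)"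
  shows "Re (q 1) = Re (q 0)" "s \<in> {0..1} \<Longrightarrow> Re (q' s) = 0"
proof -
  have i: "((\<lambda>s. Re (q' s)) has_integral (Re (q 1) - Re (q 0))) {0..1}"
    by (rule fundamental_theorem_of_calculus)
       (auto intro!: bounded_linear.has_vector_derivative[OF bounded_linear_Re] d)
  have "0 \<le> Re (q 1) - Re (q 0)" by (rule has_integral_nonneg[OF i n])
  then show 1: "Re (q 1) = Re (q 0)" using e by simp
  have cr: "continuous_on {0..1} (\<lambda>s. Re (q' s))" by (intro continuous_intros c)
  have "integral {0..1} (\<lambda>s. Re (q' s)) = 0" using i 1 by (simp add: integral_unique)
  then show "s \<in> {0..1} \<Longrightarrow> Re (q' s) = 0"
    using integral_eq_0_iff[OF cr] n by auto
qed

lemma has_vector_derivative_mult_cnj: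
  assumes "(f has_vector_derivative f') (at s within S)" "(g has_vector_derivative g') (at s within S)"
  shows "((\<lambda>s. f s * cnj (g s)) has_vector_derivative f s * cnj g' + f' * cnj (g s)) (at s within S)"
  by (rule has_vector_derivative_mult[OF assms(1) bounded_linear.has_vector_derivative[OF bounded_linear_cnj assms(2)]])

text \<open>For an eigenfunction \<open>z\<close> put \<open>v = \<lambda>z\<close>. The real part of
  \<open>q = (\<alpha>z' - z''') v\<^sup>* + z'' v'\<^sup>* - B v v\<^sup>*\<close> has derivative \<open>Re \<lambda>\<close> times the energy density, vanishes
  at \<open>0\<close> and is \<open>- \<kappa>\<bar>v'\<bar>\<^sup>2 - B\<bar>v\<bar>\<^sup>2\<close> at \<open>1\<close>.\<close>

lemma energy_identity:
  fixes \<alpha> B \<kappa> :: real and l :: complex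
  assumes z: "ode_sol (of_real \<alpha>) (2 * of_real B * l) (l\<^sup>2) (\<lambda>_. 0) z0 z1 z2 z3"
    and bc: "z0 0 = 0" "z2 0 = 0" "z2 1 + (of_real \<kappa> * l) * z1 1 = 0" "z3 1 - of_real \<alpha> * z1 1 = 0"
    and pos: "0 \<le> \<alpha>" "0 \<le> B" "0 \<le> \<kappa>" "0 \<le> Re l"
  shows "\<kappa> * (cmod (l * z1 1))\<^sup>2 = 0" "B * (cmod (l * z0 1))\<^sup>2 = 0"
    "s \<in> {0..1} \<Longrightarrow> Re l * ((cmod (z2 s))\<^sup>2 + \<alpha> * (cmod (z1 s))\<^sup>2 + (cmod (l * z0 s))\<^sup>2) = 0"
proof -
  note D = ode_sol_homogeneous_derivs[OF z]
  define q where "q s = cnj l * (of_real \<alpha> * (z1 s * cnj (z0 s)) - z3 s * cnj (z0 s) + z2 s * cnj (z1 s))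
     - of_real B * (l * cnj l * (z0 s * cnj (z0 s)))" for s
  define q' where "q' s = cnj l * (of_real \<alpha> * (z1 s * cnj (z1 s) + z2 s * cnj (z0 s))
      - (z3 s * cnj (z1 s) + (of_real \<alpha> * z2 s - 2 * of_real B * l * z1 s - l\<^sup>2 * z0 s) * cnj (z0 s))
      + (z2 s * cnj (z2 s) + z3 s * cnj (z1 s)))
     - of_real B * (l * cnj l * (z0 s * cnj (z1 s) + z1 s * cnj (z0 s)))" for s
  have d: "(q has_vector_derivative q' s) (at s within {0..1})" if "s \<in> {0..1}" for s
    unfolding q_def q'_def
    by (intro has_vector_derivative_add has_vector_derivative_diff has_vector_derivative_mult_right
        has_vector_derivative_mult_cnj D that)
  have c: "continuous_on {0..1} q'"
    unfolding q'_def by (intro continuous_intros D)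
  \<comment> \<open>In q' the mixed terms with factor \<alpha> and those in z3 cnj(z1) cancel. The
    damping contributes 2B|l|^2 z1 cnj(z0), whose real part is offset by the derivative of the last
    summand of q, and cnj(l) l^2 = |l|^2 l produces the kinetic term.\<close>
  have re: "Re (q' s) = Re l * ((cmod (z2 s))\<^sup>2 + \<alpha> * (cmod (z1 s))\<^sup>2 + (cmod (l * z0 s))\<^sup>2)" for s
    unfolding q'_def cmod_power2 by (simp add: algebra_simps power2_eq_square)
  have n: "0 \<le> Re (q' s)" for s unfolding re using pos by simp
  have q1: "Re (q 1) = - (\<kappa> * (cmod (l * z1 1))\<^sup>2) - B * (cmod (l * z0 1))\<^sup>2"
  proof -
    have "z2 1 = - (of_real \<kappa> * l * z1 1)" "z3 1 = of_real \<alpha> * z1 1"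
      using bc(3,4) by (simp_all add: eq_neg_iff_add_eq_0)
    then show ?thesis unfolding q_def cmod_power2 by (simp add: algebra_simps power2_eq_square)
  qed
  have q0: "Re (q 0) = 0" unfolding q_def using bc by simp
  have nn: "0 \<le> \<kappa> * (cmod (l * z1 1))\<^sup>2" "0 \<le> B * (cmod (l * z0 1))\<^sup>2" using pos by auto
  have le: "Re (q 1) \<le> Re (q 0)" unfolding q0 q1 using nn by simp
  note r = nonneg_derivative_vanishes[OF d c n le]
  show "\<kappa> * (cmod (l * z1 1))\<^sup>2 = 0" "B * (cmod (l * z0 1))\<^sup>2 = 0"
    using r(1) nn unfolding q0 q1 by linarith+
  show "s \<in> {0..1} \<Longrightarrow> Re l * ((cmod (z2 s))\<^sup>2 + \<alpha> * (cmod (z1 s))\<^sup>2 + (cmod (l * z0 s))\<^sup>2) = 0"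
    using r(2)[of s] unfolding re .
qed

text \<open>Dividing by Re l > 0 makes the energy density vanish. Its last term |l z|^2 already
  settles z, because l is nonzero.\<close>

lemma nondeg_right_half_plane:
  fixes \<alpha> B \<kappa> :: real
  assumes "0 \<le> \<alpha>" "0 \<le> B" "0 \<le> \<kappa>" "0 < Re l"
  shows "nondeg (of_real \<alpha>) (2 * of_real B * l) (l\<^sup>2) (of_real \<kappa> * l)"
  unfolding nondeg_def
proof (intro allI impI ballI, elim conjE)
  fix z0 z1 z2 z3 and s :: real
  assume z: "ode_sol (of_real \<alpha>) (2 * of_real B * l) (l\<^sup>2) (\<lambda>_. 0) z0 z1 z2 z3" "z0 0 = 0" "z2 0 = 0"
    "z2 1 + of_real \<kappa> * l * z1 1 = 0" "z3 1 - of_real \<alpha> * z1 1 = 0" and s: "s \<in> {0..1}"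
  have "(cmod (z2 s))\<^sup>2 + \<alpha> * (cmod (z1 s))\<^sup>2 + (cmod (l * z0 s))\<^sup>2 = 0"
    using energy_identity(3)[OF z assms(1-3) _ s] assms(4) by simp
  moreover have "0 \<le> (cmod (z2 s))\<^sup>2" "0 \<le> \<alpha> * (cmod (z1 s))\<^sup>2" "0 \<le> (cmod (l * z0 s))\<^sup>2"
    using assms by auto
  ultimately have "(cmod (l * z0 s))\<^sup>2 = 0" by linarith
  then show "z0 s = 0" using assms(4) by auto
qed

text \<open>At the origin v = 0 and \<open>energy_identity\<close> says nothing. Testing with w
  itself gives the static energy |w''|^2 + \<alpha>|w'|^2 as density, and the conditions at 1
  annihilate \<open>q\<close> there. As \<alpha> > 0, w' vanishes and w stays at its value
  0.\<close>

lemma nondeg_origin: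
  fixes \<alpha> :: real
  assumes "0 < \<alpha>"
  shows "nondeg (of_real \<alpha>) 0 0 0"
  unfolding nondeg_def
proof (intro allI impI ballI, elim conjE)
  fix z0 z1 z2 z3 and s :: real
  assume z: "ode_sol (of_real \<alpha>) 0 0 (\<lambda>_. 0) z0 z1 z2 z3" "z0 0 = 0" "z2 0 = 0"
    "z2 1 + 0 * z1 1 = 0" "z3 1 - of_real \<alpha> * z1 1 = 0" and s: "s \<in> {0..1}"
  note D = ode_sol_homogeneous_derivs[OF z(1)]
  define q where "q s = of_real \<alpha> * (z1 s * cnj (z0 s)) - z3 s * cnj (z0 s) + z2 s * cnj (z1 s)" for s
  define q' where "q' s = of_real \<alpha> * (z1 s * cnj (z1 s) + z2 s * cnj (z0 s))
      - (z3 s * cnj (z1 s) + (of_real \<alpha> * z2 s - 0 * z1 s - 0 * z0 s) * cnj (z0 s))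
      + (z2 s * cnj (z2 s) + z3 s * cnj (z1 s))" for s
  have d: "(q has_vector_derivative q' s) (at s within {0..1})" if "s \<in> {0..1}" for s
    unfolding q_def q'_def
    by (intro has_vector_derivative_add has_vector_derivative_diff has_vector_derivative_mult_right
        has_vector_derivative_mult_cnj D that)
  have c: "continuous_on {0..1} q'"
    unfolding q'_def by (intro continuous_intros D)
  have re: "Re (q' s) = (cmod (z2 s))\<^sup>2 + \<alpha> * (cmod (z1 s))\<^sup>2" for s
    unfolding q'_def cmod_power2 by (simp add: algebra_simps power2_eq_square)
  have n: "0 \<le> Re (q' s)" for s unfolding re using assms by simp
  have "z2 1 = 0" "z3 1 = of_real \<alpha> * z1 1" using z(4,5) by simp_all
  then have "q 1 = 0" unfolding q_def by (simp add: algebra_simps)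
  then have le: "Re (q 1) \<le> Re (q 0)" unfolding q_def using z by simp
  have z1: "z1 t = 0" if "t \<in> {0..1}" for t
  proof -
    have "(cmod (z2 t))\<^sup>2 + \<alpha> * (cmod (z1 t))\<^sup>2 = 0"
      using nonneg_derivative_vanishes(2)[OF d c n le that] unfolding re .
    moreover have "0 \<le> (cmod (z2 t))\<^sup>2" "0 \<le> \<alpha> * (cmod (z1 t))\<^sup>2" using assms by auto
    ultimately have "\<alpha> * (cmod (z1 t))\<^sup>2 = 0" by linarith
    then show ?thesis using assms by simp
  qed
  have "z0 s - z0 0 = integral {0..s} z1"
    using z(1) s by (intro prim_diff) (auto simp: ode_sol_def)
  also have "\<dots> = integral {0..s} (\<lambda>_. 0)"
    by (rule Henstock_Kurzweil_Integration.integral_cong) (use z1 s in auto)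
  finally show "z0 s = 0" using z(2) by simp
qed

lemma Re_mult_cnj_bound: "\<bar>2 * Re (u * x * cnj y)\<bar> \<le> cmod u * ((cmod x)\<^sup>2 + (cmod y)\<^sup>2)"
proof -
  have "\<bar>2 * Re (u * x * cnj y)\<bar> \<le> 2 * cmod (u * x * cnj y)"
    using abs_Re_le_cmod[of "u * x * cnj y"] by linarith
  also have "\<dots> = cmod u * (2 * cmod x * cmod y)" by (simp add: norm_mult)
  also have "\<dots> \<le> cmod u * ((cmod x)\<^sup>2 + (cmod y)\<^sup>2)"
    by (intro mult_left_mono sum_squares_bound) auto
  finally show ?thesis .
qed

text \<open>Backward uniqueness by Gronwall's argument: \<open>e\<^bsup>Cs\<^esup>\<close> times the sum of the
  \<open>\<bar>z\<^sub>i\<bar>\<^sup>2\<close> is nondecreasing and vanishes at \<open>1\<close>.\<close>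

lemma ode_sol_backward_unique:
  assumes z: "ode_sol \<alpha> b m (\<lambda>_. 0) z0 z1 z2 z3"
    and e: "z0 1 = 0" "z1 1 = 0" "z2 1 = 0" "z3 1 = 0" and s: "s \<in> {0..1}"
  shows "z0 s = 0"
proof -
  note D = ode_sol_homogeneous_derivs[OF z]
  \<comment> \<open>Each |z_i|^2 occurs at most twice among the three products of neighbouring
    derivatives, which gives the 2; the equation for the derivative of z3 gives |\<alpha>| + |b| +
    |m|.\<close>
  define C where "C = 2 + cmod \<alpha> + cmod b + cmod m"
  define N where "N s = (cmod (z0 s))\<^sup>2 + (cmod (z1 s))\<^sup>2 + (cmod (z2 s))\<^sup>2 + (cmod (z3 s))\<^sup>2" for s
  define q where "q s = z0 s * cnj (z0 s) + z1 s * cnj (z1 s) + z2 s * cnj (z2 s) + z3 s * cnj (z3 s)" for s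
  define w where "w s = \<alpha> * z2 s - b * z1 s - m * z0 s" for s
  define q' where "q' s = (z0 s * cnj (z1 s) + z1 s * cnj (z0 s)) + (z1 s * cnj (z2 s) + z2 s * cnj (z1 s)) +
     (z2 s * cnj (z3 s) + z3 s * cnj (z2 s)) + (z3 s * cnj (w s) + w s * cnj (z3 s))" for s
  have d: "(q has_vector_derivative q' s) (at s within {0..1})" if "s \<in> {0..1}" for s
    unfolding q_def q'_def w_def
    by (intro has_vector_derivative_add has_vector_derivative_mult_cnj D that)
  have qN: "Re (q s) = N s" for s
    unfolding q_def N_def cmod_power2 by (simp add: power2_eq_square)
  have bound: "- C * N s \<le> Re (q' s)" for s
  proof -
    have re: "Re (q' s) = 2 * Re (1 * z1 s * cnj (z0 s)) + 2 * Re (1 * z2 s * cnj (z1 s)) + 2 * Re (1 * z3 s * cnj (z2 s))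
       + (2 * Re (\<alpha> * z2 s * cnj (z3 s)) - 2 * Re (b * z1 s * cnj (z3 s)) - 2 * Re (m * z0 s * cnj (z3 s)))"
      unfolding q'_def w_def by (simp add: algebra_simps)
    have k: "\<bar>2 * Re (u * x * cnj y)\<bar> \<le> cmod u * ((cmod x)\<^sup>2 + (cmod y)\<^sup>2)" for u x y
      by (rule Re_mult_cnj_bound)
    have k': "\<bar>2 * Re (u * x * cnj y)\<bar> \<le> cmod u * N s" if "(cmod x)\<^sup>2 + (cmod y)\<^sup>2 \<le> N s" for u x y
      using k[of u x y] mult_left_mono[OF that, of "cmod u"] by simp
    have sq: "0 \<le> (cmod (z0 s))\<^sup>2" "0 \<le> (cmod (z1 s))\<^sup>2" "0 \<le> (cmod (z2 s))\<^sup>2" "0 \<le> (cmod (z3 s))\<^sup>2" by simp_all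
    have "\<bar>2 * Re (1 * z1 s * cnj (z0 s))\<bar> \<le> (cmod (z1 s))\<^sup>2 + (cmod (z0 s))\<^sup>2"
      "\<bar>2 * Re (1 * z2 s * cnj (z1 s))\<bar> \<le> (cmod (z2 s))\<^sup>2 + (cmod (z1 s))\<^sup>2"
      "\<bar>2 * Re (1 * z3 s * cnj (z2 s))\<bar> \<le> (cmod (z3 s))\<^sup>2 + (cmod (z2 s))\<^sup>2"
      using k[of 1] by simp_all
    moreover have "\<bar>2 * Re (\<alpha> * z2 s * cnj (z3 s))\<bar> \<le> cmod \<alpha> * N s"
      "\<bar>2 * Re (b * z1 s * cnj (z3 s))\<bar> \<le> cmod b * N s" "\<bar>2 * Re (m * z0 s * cnj (z3 s))\<bar> \<le> cmod m * N s"
      using sq by (intro k'; simp add: N_def)+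
    moreover have "(cmod (z1 s))\<^sup>2 + (cmod (z0 s))\<^sup>2 + ((cmod (z2 s))\<^sup>2 + (cmod (z1 s))\<^sup>2) + ((cmod (z3 s))\<^sup>2 + (cmod (z2 s))\<^sup>2) \<le> 2 * N s"
      using sq by (simp add: N_def)
    moreover have "C * N s = 2 * N s + cmod \<alpha> * N s + cmod b * N s + cmod m * N s"
      by (simp add: C_def algebra_simps)
    ultimately show ?thesis unfolding re by linarith
  qed
  have dE: "((\<lambda>s. complex_of_real (exp (C * s))) has_vector_derivative complex_of_real (C * exp (C * s))) (at s within {0..1})" for s
    by (intro has_vector_derivative_of_real)
       (auto intro!: derivative_eq_intros simp flip: has_real_derivative_iff_has_vector_derivative)
  have d2: "((\<lambda>s. complex_of_real (exp (C * s)) * q s) has_vector_derivative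
      complex_of_real (exp (C * s)) * q' s + complex_of_real (C * exp (C * s)) * q s) (at s within {0..1})"
    if "s \<in> {0..1}" for s by (intro has_vector_derivative_mult dE d that)
  have "((\<lambda>t. Re (complex_of_real (exp (C * t)) * q' t + complex_of_real (C * exp (C * t)) * q t)) has_integral
      (Re (complex_of_real (exp (C * 1)) * q 1) - Re (complex_of_real (exp (C * s)) * q s))) {s..1}"
  proof (rule fundamental_theorem_of_calculus)
    fix t assume "t \<in> {s..1}"
    then show "((\<lambda>t. Re (complex_of_real (exp (C * t)) * q t)) has_vector_derivative
        Re (complex_of_real (exp (C * t)) * q' t + complex_of_real (C * exp (C * t)) * q t)) (at t within {s..1})"
      by (intro bounded_linear.has_vector_derivative[OF bounded_linear_Re has_vector_derivative_within_subset[OF d2]])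
         (use s in auto)
  qed (use s in auto)
  moreover have "0 \<le> Re (complex_of_real (exp (C * t)) * q' t + complex_of_real (C * exp (C * t)) * q t)" for t
  proof -
    have "0 \<le> exp (C * t) * (Re (q' t) + C * N t)" using bound[of t] by (intro mult_nonneg_nonneg) auto
    also have "\<dots> = Re (complex_of_real (exp (C * t)) * q' t + complex_of_real (C * exp (C * t)) * q t)"
      by (simp add: algebra_simps flip: qN)
    finally show ?thesis .
  qed
  ultimately have "0 \<le> Re (complex_of_real (exp (C * 1)) * q 1) - Re (complex_of_real (exp (C * s)) * q s)"
    by (rule has_integral_nonneg)
  moreover have "q 1 = 0" using e by (simp add: q_def)
  ultimately have "exp (C * s) * N s \<le> 0" by (simp add: qN)
  then have "N s \<le> 0" by (simp add: mult_le_0_iff)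
  moreover have "0 \<le> (cmod (z0 s))\<^sup>2" "0 \<le> (cmod (z1 s))\<^sup>2" "0 \<le> (cmod (z2 s))\<^sup>2" "0 \<le> (cmod (z3 s))\<^sup>2" by simp_all
  ultimately have "(cmod (z0 s))\<^sup>2 = 0" unfolding N_def by linarith
  then show ?thesis by simp
qed

text \<open>\<kappa> > 0 forces l z'(1) = 0 and B > 0 forces l z(1) = 0, whence l must be nonzero.
  The conditions at 1 then give z''(1) = z'''(1) = 0, and backward uniqueness applies.\<close>

lemma nondeg_closed_right_half_plane:
  fixes \<alpha> B \<kappa> :: real
  assumes "0 \<le> \<alpha>" "0 < B" "0 < \<kappa>" "0 \<le> Re l" "l \<noteq> 0"
  shows "nondeg (of_real \<alpha>) (2 * of_real B * l) (l\<^sup>2) (of_real \<kappa> * l)"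
  unfolding nondeg_def
proof (intro allI impI ballI, elim conjE)
  fix z0 z1 z2 z3 and s :: real
  assume z: "ode_sol (of_real \<alpha>) (2 * of_real B * l) (l\<^sup>2) (\<lambda>_. 0) z0 z1 z2 z3" "z0 0 = 0" "z2 0 = 0"
    "z2 1 + of_real \<kappa> * l * z1 1 = 0" "z3 1 - of_real \<alpha> * z1 1 = 0" and s: "s \<in> {0..1}"
  have "z1 1 = 0" "z0 1 = 0"
    using energy_identity(1,2)[OF z assms(1) _ _ assms(4)] assms by auto
  then show "z0 s = 0"
    using z(4,5) by (intro ode_sol_backward_unique[OF z(1) _ _ _ _ s]) auto
qed

section \<open>The spectrum of the closed-loop operator\<close>

lemma sobolev_2_iff:
  "u \<in> sobolev 2 \<longleftrightarrow> (\<exists>u0 u1 u2. u = abs_L2 u0 \<and> prim u0 u1 \<and> prim u1 u2)"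
proof
  assume "u \<in> sobolev 2"
  then obtain g h where gh: "has_weak_deriv u g" "has_weak_deriv g h" by (auto simp: numeral_2_eq_2)
  obtain u2 where u2: "square_integrable u2" "h = abs_L2 u2" by (rule abs_L2_cases)
  obtain u1 where u1: "g = abs_L2 u1" "prim u1 u2" using has_weak_derivE gh(2) u2 by blast
  obtain u0 where u0: "u = abs_L2 u0" "prim u0 u1"
    using has_weak_derivE[of u u1] gh(1) u1 prim_sq_int[OF u1(2)] by blast
  show "\<exists>u0 u1 u2. u = abs_L2 u0 \<and> prim u0 u1 \<and> prim u1 u2" using u0 u1 by blast
next
  assume "\<exists>u0 u1 u2. u = abs_L2 u0 \<and> prim u0 u1 \<and> prim u1 u2"
  then show "u \<in> sobolev 2" by (auto simp: numeral_2_eq_2 dest!: has_weak_deriv_abs_L2)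
qed

lemma sobolev_4_iff:
  "u \<in> sobolev 4 \<longleftrightarrow>
    (\<exists>u0 u1 u2 u3 u4. u = abs_L2 u0 \<and> prim u0 u1 \<and> prim u1 u2 \<and> prim u2 u3 \<and> prim u3 u4)"
proof -
  have 4: "(4::nat) = Suc (Suc 2)" by simp
  show ?thesis
  proof
    assume "u \<in> sobolev 4"
    then obtain g h where gh: "has_weak_deriv u g" "has_weak_deriv g h" "h \<in> sobolev 2"
      unfolding 4 sobolev.simps by blast
    obtain u2 u3 u4 where h: "h = abs_L2 u2" "prim u2 u3" "prim u3 u4"
      using gh(3) unfolding sobolev_2_iff by blast
    obtain u1 where u1: "g = abs_L2 u1" "prim u1 u2"
      using has_weak_derivE[of g u2] gh(2) h prim_sq_int[OF h(2)] by blast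
    obtain u0 where u0: "u = abs_L2 u0" "prim u0 u1"
      using has_weak_derivE[of u u1] gh(1) u1 prim_sq_int[OF u1(2)] by blast
    show "\<exists>u0 u1 u2 u3 u4. u = abs_L2 u0 \<and> prim u0 u1 \<and> prim u1 u2 \<and> prim u2 u3 \<and> prim u3 u4"
      using u0 u1 h by blast
  next
    assume "\<exists>u0 u1 u2 u3 u4. u = abs_L2 u0 \<and> prim u0 u1 \<and> prim u1 u2 \<and> prim u2 u3 \<and> prim u3 u4"
    then obtain u0 u1 u2 u3 u4 where u: "u = abs_L2 u0" "prim u0 u1" "prim u1 u2" "prim u2 u3" "prim u3 u4"
      by blast
    have "abs_L2 u2 \<in> sobolev 2" unfolding sobolev_2_iff using u by blast
    then show "u \<in> sobolev 4"
      unfolding 4 sobolev.simps using has_weak_deriv_abs_L2 u by blast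
  qed
qed

lemma weak_deriv_pow_abs_L2:
  assumes "prim u0 u1" "prim u1 u2"
  shows "(weak_deriv ^^ 2) (abs_L2 u0) = abs_L2 u2"
    and "prim u2 u3 \<Longrightarrow> (weak_deriv ^^ 3) (abs_L2 u0) = abs_L2 u3"
    and "prim u2 u3 \<Longrightarrow> prim u3 u4 \<Longrightarrow> (weak_deriv ^^ 4) (abs_L2 u0) = abs_L2 u4"
  using assms by (simp_all add: eval_nat_numeral weak_deriv_abs_L2)

lemma point_value_prim: "prim f g \<Longrightarrow> s \<in> {0..1} \<Longrightarrow> point_value (abs_L2 f) s = f s"
  by (rule point_value_abs_L2[OF prim_continuous])

lemma X_space_iff:
  "(w, v) \<in> X_space \<longleftrightarrow>
    (\<exists>w0 w1 w2. w = abs_L2 w0 \<and> prim w0 w1 \<and> prim w1 w2 \<and> w0 0 = 0)"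
  unfolding X_space_def sobolev0_def mem_Times_iff
  by (auto simp: sobolev_2_iff) (metis atLeastAtMost_iff order_refl zero_le_one point_value_prim)+

lemma T_domI:
  assumes "prim w0 w1" "prim w1 w2" "prim w2 w3" "prim w3 w4" "prim v0 v1" "prim v1 v2"
    "w0 0 = 0" "v0 0 = 0" "w2 0 = 0" "w2 1 + of_real \<kappa> * v1 1 = 0"
    "w3 1 - of_real (\<gamma> - \<eta>\<^sup>2) * w1 1 = 0"
  shows "(abs_L2 w0, abs_L2 v0) \<in> T_dom \<eta> \<kappa> \<gamma>"
proof -
  have "abs_L2 w0 \<in> sobolev 4" "abs_L2 w0 \<in> sobolev 2" "abs_L2 v0 \<in> sobolev 2"
    unfolding sobolev_2_iff sobolev_4_iff using assms(1-6) by blast+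
  then show ?thesis
    unfolding T_dom_def A_dom_def X_space_def sobolev0_def
    using assms(7-)
    by (simp add: weak_deriv_pow_abs_L2[OF assms(1,2)] weak_deriv_pow_abs_L2(2)[OF assms(1,2,3)]
        weak_deriv_abs_L2[OF assms(1)] weak_deriv_abs_L2[OF assms(5)]
        point_value_prim[OF assms(1)] point_value_prim[OF assms(2)] point_value_prim[OF assms(3)]
        point_value_prim[OF assms(4)] point_value_prim[OF assms(5)] point_value_prim[OF assms(6)])
qed

lemma T_domE:
  assumes "x \<in> T_dom \<eta> \<kappa> \<gamma>"
  obtains w0 w1 w2 w3 w4 v0 v1 v2 where "x = (abs_L2 w0, abs_L2 v0)"
    "prim w0 w1" "prim w1 w2" "prim w2 w3" "prim w3 w4" "prim v0 v1" "prim v1 v2"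
    "w0 0 = 0" "v0 0 = 0" "w2 0 = 0" "w2 1 + of_real \<kappa> * v1 1 = 0"
    "w3 1 - of_real (\<gamma> - \<eta>\<^sup>2) * w1 1 = 0"
proof -
  obtain w v where x: "x = (w, v)" by (cases x)
  have d: "w \<in> sobolev 4" "v \<in> sobolev 2" "point_value w 0 = 0" "point_value v 0 = 0"
     "point_value ((weak_deriv ^^ 2) w) 0 = 0"
     "point_value ((weak_deriv ^^ 2) w) 1 + of_real \<kappa> * point_value (weak_deriv v) 1 = 0"
     "point_value ((weak_deriv ^^ 3) w) 1 - of_real (\<gamma> - \<eta>\<^sup>2) * point_value (weak_deriv w) 1 = 0"
    using assms unfolding T_dom_def A_dom_def x sobolev0_def by blast+
  obtain w0 w1 w2 w3 w4 where w: "w = abs_L2 w0" "prim w0 w1" "prim w1 w2" "prim w2 w3" "prim w3 w4"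
    using d(1) unfolding sobolev_4_iff by blast
  obtain v0 v1 v2 where v: "v = abs_L2 v0" "prim v0 v1" "prim v1 v2"
    using d(2) unfolding sobolev_2_iff by blast
  have bc: "w0 0 = 0" "v0 0 = 0" "w2 0 = 0" "w2 1 + of_real \<kappa> * v1 1 = 0"
    "w3 1 - of_real (\<gamma> - \<eta>\<^sup>2) * w1 1 = 0"
    using d(3-7) unfolding w(1) v(1)
    by (simp_all add: weak_deriv_pow_abs_L2[OF w(2,3)] weak_deriv_pow_abs_L2(2)[OF w(2,3,4)]
        weak_deriv_abs_L2[OF w(2)] weak_deriv_abs_L2[OF v(2)]
        point_value_prim[OF w(2)] point_value_prim[OF w(3)] point_value_prim[OF w(4)]
        point_value_prim[OF w(5)] point_value_prim[OF v(2)] point_value_prim[OF v(3)])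
  show thesis by (rule that[OF _ w(2-5) v(2,3) bc]) (simp add: x w(1) v(1))
qed

lemma shifted_T_op_abs_L2:
  assumes "prim w0 w1" "prim w1 w2" "prim w2 w3" "prim w3 w4" "prim v0 v1"
  shows "X_scale z (abs_L2 w0, abs_L2 v0) - T_op \<beta> \<eta> \<gamma> (abs_L2 w0, abs_L2 v0) =
    (abs_L2 (\<lambda>s. z * w0 s - v0 s),
     abs_L2 (\<lambda>s. z * v0 s + w4 s - of_real (\<gamma> - \<eta>\<^sup>2) * w2 s + 2 * of_real (\<beta> * \<eta>) * v1 s))"
proof -
  have sq: "square_integrable w0" "square_integrable w2" "square_integrable w4"
      "square_integrable v0" "square_integrable v1"
    using assms prim_sq_int primD(1) by blast+
  note sc = square_integrable_scale[OF sq(1)] square_integrable_scale[OF sq(2)]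
    square_integrable_scale[OF sq(3)] square_integrable_scale[OF sq(4)] square_integrable_scale[OF sq(5)]
  have eq: "X_scale z (abs_L2 w0, abs_L2 v0) - T_op \<beta> \<eta> \<gamma> (abs_L2 w0, abs_L2 v0) =
    (l2_scale z (abs_L2 w0) - abs_L2 v0, l2_scale z (abs_L2 v0) + abs_L2 w4
      - l2_scale (of_real (\<gamma> - \<eta>\<^sup>2)) (abs_L2 w2) - l2_scale (of_real (- 2 * \<beta> * \<eta>)) (abs_L2 v1))"
    unfolding X_scale_def T_op_def A_op_def B_op_def
    by (simp add: weak_deriv_pow_abs_L2[OF assms(1,2)] weak_deriv_pow_abs_L2(3)[OF assms(1-4)]
        weak_deriv_abs_L2[OF assms(5)] algebra_simps del: of_real_diff of_real_mult)
  have snd: "l2_scale z (abs_L2 v0) + abs_L2 w4 - l2_scale a (abs_L2 w2) - l2_scale b (abs_L2 v1) =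
      abs_L2 (\<lambda>s. z * v0 s + w4 s - a * w2 s - b * v1 s)" for a b
    by (simp add: abs_L2_scale abs_L2_add abs_L2_diff sq sc square_integrable_add square_integrable_scale sq_int_minus)
  have fst: "l2_scale z (abs_L2 w0) - abs_L2 v0 = abs_L2 (\<lambda>s. z * w0 s - v0 s)"
    by (simp add: abs_L2_scale abs_L2_diff sq sc)
  show ?thesis unfolding eq fst snd by (simp add: mult.assoc)
qed

lemma X_norm_abs_L2:
  assumes "prim w0 w1" "prim w1 w2" "square_integrable v0"
  shows "X_norm \<eta> \<gamma> (abs_L2 w0, abs_L2 v0) =
    sqrt ((l2n w2)\<^sup>2 + (\<gamma> - \<eta>\<^sup>2) * (l2n w1)\<^sup>2 + (l2n v0)\<^sup>2)"
  unfolding X_norm_def X_inner_def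
  by (simp add: weak_deriv_abs_L2[OF assms(1)] weak_deriv_abs_L2[OF assms(2)] l2_inner_abs_L2_self
      primD(1)[OF assms(1)] primD(1)[OF assms(2)] assms(3) flip: of_real_power)

text \<open>The parameters left after eliminating v = z w: the damping 2\<beta>\<eta>v' gives b, the
  term z v gives m, and \<kappa>v'(1) gives p.\<close>

abbreviation T_nondeg :: "real \<Rightarrow> real \<Rightarrow> real \<Rightarrow> real \<Rightarrow> complex \<Rightarrow> bool" where
  "T_nondeg \<beta> \<eta> \<kappa> \<gamma> z \<equiv>
     nondeg (of_real (\<gamma> - \<eta>\<^sup>2)) (2 * of_real (\<beta> * \<eta>) * z) (z\<^sup>2) (of_real \<kappa> * z)"

lemma prim_minus:
  assumes "prim f g" "prim f' g'"
  shows "prim (\<lambda>s. f s - f' s) (\<lambda>s. g s - g' s)"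
  using prim_add[OF assms(1) prim_scale[OF assms(2), of "-1"]] by simp

text \<open>Two preimages of one element differ by functions u0 and d0 with d0 = z u0 on all of
  [0,1]. This eliminates d0 from the equation and from the condition at 1, and the rest is the
  homogeneous problem for u0.\<close>

lemma shifted_T_op_inj:
  assumes nd: "T_nondeg \<beta> \<eta> \<kappa> \<gamma> z"
  shows "inj_on (\<lambda>x. X_scale z x - T_op \<beta> \<eta> \<gamma> x) (T_dom \<eta> \<kappa> \<gamma>)"
proof (rule inj_onI)
  fix x y
  assume x: "x \<in> T_dom \<eta> \<kappa> \<gamma>" and y: "y \<in> T_dom \<eta> \<kappa> \<gamma>"
    and e: "X_scale z x - T_op \<beta> \<eta> \<gamma> x = X_scale z y - T_op \<beta> \<eta> \<gamma> y"
  obtain w0 w1 w2 w3 w4 v0 v1 v2 where w: "x = (abs_L2 w0, abs_L2 v0)"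
    "prim w0 w1" "prim w1 w2" "prim w2 w3" "prim w3 w4" "prim v0 v1" "prim v1 v2"
    "w0 0 = 0" "v0 0 = 0" "w2 0 = 0" "w2 1 + of_real \<kappa> * v1 1 = 0"
    "w3 1 - of_real (\<gamma> - \<eta>\<^sup>2) * w1 1 = 0" using x by (rule T_domE)
  obtain w0' w1' w2' w3' w4' v0' v1' v2' where w': "y = (abs_L2 w0', abs_L2 v0')"
    "prim w0' w1'" "prim w1' w2'" "prim w2' w3'" "prim w3' w4'" "prim v0' v1'" "prim v1' v2'"
    "w0' 0 = 0" "v0' 0 = 0" "w2' 0 = 0" "w2' 1 + of_real \<kappa> * v1' 1 = 0"
    "w3' 1 - of_real (\<gamma> - \<eta>\<^sup>2) * w1' 1 = 0" using y by (rule T_domE)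
  define u0 u1 u2 u3 u4 d0 d1 where u: "u0 = (\<lambda>s. w0 s - w0' s)" "u1 = (\<lambda>s. w1 s - w1' s)"
    "u2 = (\<lambda>s. w2 s - w2' s)" "u3 = (\<lambda>s. w3 s - w3' s)" "u4 = (\<lambda>s. w4 s - w4' s)"
    "d0 = (\<lambda>s. v0 s - v0' s)" "d1 = (\<lambda>s. v1 s - v1' s)"
  have p: "prim u0 u1" "prim u1 u2" "prim u2 u3" "prim u3 u4" "prim d0 d1"
    unfolding u using w w' by (auto intro!: prim_minus)
  have cd: "continuous_on {0..1} d1" and cu: "continuous_on {0..1} u1"
    unfolding u using prim_continuous w(3,7) w'(3,7) by (auto intro!: continuous_intros)
  have sq: "square_integrable w0" "square_integrable w2" "square_integrable w4"
      "square_integrable v0" "square_integrable v1"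
    using w prim_sq_int primD(1) by blast+
  have sq': "square_integrable w0'" "square_integrable w2'" "square_integrable w4'"
      "square_integrable v0'" "square_integrable v1'"
    using w' prim_sq_int primD(1) by blast+
  have e1: "abs_L2 (\<lambda>s. z * w0 s - v0 s) = abs_L2 (\<lambda>s. z * w0' s - v0' s)"
    and e2: "abs_L2 (\<lambda>s. z * v0 s + w4 s - of_real (\<gamma> - \<eta>\<^sup>2) * w2 s + 2 * of_real (\<beta> * \<eta>) * v1 s) =
       abs_L2 (\<lambda>s. z * v0' s + w4' s - of_real (\<gamma> - \<eta>\<^sup>2) * w2' s + 2 * of_real (\<beta> * \<eta>) * v1' s)"
    using e unfolding w(1) w'(1) shifted_T_op_abs_L2[OF w(2-6)] shifted_T_op_abs_L2[OF w'(2-6)] by blast+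
  have a1: "AE s in unit_ivl. z * w0 s - v0 s = z * w0' s - v0' s"
    using e1 by (subst (asm) abs_L2_eq_iff) (intro sq_int_minus square_integrable_scale sq sq')+
  have a2: "AE s in unit_ivl. z * v0 s + w4 s - of_real (\<gamma> - \<eta>\<^sup>2) * w2 s + 2 * of_real (\<beta> * \<eta>) * v1 s =
       z * v0' s + w4' s - of_real (\<gamma> - \<eta>\<^sup>2) * w2' s + 2 * of_real (\<beta> * \<eta>) * v1' s"
    using e2 by (subst (asm) abs_L2_eq_iff) (intro sq_int_minus square_integrable_add square_integrable_scale sq sq')+
  have d0: "d0 s = z * u0 s" if "s \<in> {0..1}" for s
  proof (rule continuous_AE_eq[OF _ _ _ that])
    show "AE s in unit_ivl. d0 s = z * u0 s"
      using a1 unfolding u by eventually_elim (simp add: algebra_simps)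
  qed (use p prim_continuous in \<open>auto intro!: continuous_intros\<close>)
  \<comment> \<open>Both d1 and z u1 are derivatives of d0, hence equal a.e. and, being continuous,
    everywhere; the moment condition needs their equality at the end point 1.\<close>
  have "prim d0 (\<lambda>s. z * u1 s)"
    by (rule prim_cong[OF prim_scale[OF p(1), of z]]) (use d0 primD(1)[OF p(1)] square_integrable_scale in auto)
  from prim_unique[OF p(5) this]
  have d1: "d1 s = z * u1 s" if "s \<in> {0..1}" for s
    by (rule continuous_AE_eq[OF cd _ _ that, rotated]) (intro continuous_intros cu)
  have ae: "AE s in unit_ivl. u4 s = 0 + of_real (\<gamma> - \<eta>\<^sup>2) * u2 s - 2 * of_real (\<beta> * \<eta>) * z * u1 s - z\<^sup>2 * u0 s"
  proof -
    have "AE s in unit_ivl. s \<in> {0<..<1}" by (intro AE_I2) auto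
    then show ?thesis using a2
    proof eventually_elim
      case (elim s)
      have "z * d0 s + u4 s - of_real (\<gamma> - \<eta>\<^sup>2) * u2 s + 2 * of_real (\<beta> * \<eta>) * d1 s = 0"
        using elim(2) unfolding u by (simp add: algebra_simps)
      then show ?case
        using elim(1) d0[of s] d1[of s] by (simp add: algebra_simps power2_eq_square)
    qed
  qed
  have p3: "prim u3 (\<lambda>s. 0 + of_real (\<gamma> - \<eta>\<^sup>2) * u2 s - 2 * of_real (\<beta> * \<eta>) * z * u1 s - z\<^sup>2 * u0 s)"
    by (rule prim_cong[OF p(4) _ ae])
       (intro sq_int_minus square_integrable_add square_integrable_scale square_integrable_zero
          prim_sq_int[OF p(1)] prim_sq_int[OF p(2)] prim_sq_int[OF p(3)], simp)
  have "ode_sol (of_real (\<gamma> - \<eta>\<^sup>2)) (2 * of_real (\<beta> * \<eta>) * z) (z\<^sup>2) (\<lambda>_. 0) u0 u1 u2 u3"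
    unfolding ode_sol_def using p p3 by blast
  moreover have "u0 0 = 0" "u2 0 = 0" unfolding u using w w' by auto
  moreover have "u2 1 + of_real \<kappa> * z * u1 1 = 0"
  proof -
    have "u2 1 + of_real \<kappa> * d1 1 = (w2 1 + of_real \<kappa> * v1 1) - (w2' 1 + of_real \<kappa> * v1' 1)"
      unfolding u by (simp add: algebra_simps)
    then show ?thesis using d1[of 1] w(11) w'(11) by (simp add: mult.assoc)
  qed
  moreover have "u3 1 - of_real (\<gamma> - \<eta>\<^sup>2) * u1 1 = 0"
  proof -
    have "u3 1 - of_real (\<gamma> - \<eta>\<^sup>2) * u1 1 =
        (w3 1 - of_real (\<gamma> - \<eta>\<^sup>2) * w1 1) - (w3' 1 - of_real (\<gamma> - \<eta>\<^sup>2) * w1' 1)"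
      unfolding u by (simp add: algebra_simps)
    then show ?thesis using w(12) w'(12) by simp
  qed
  ultimately have u0: "u0 s = 0" if "s \<in> {0..1}" for s
    using nd that unfolding nondeg_def by blast
  have d00: "d0 s = 0" if "s \<in> {0..1}" for s using u0 d0 that by simp
  have "abs_L2 w0 = abs_L2 w0'"
    unfolding abs_L2_eq_iff[OF sq(1) sq'(1)] using u0 by (intro AE_I2) (auto simp: u)
  moreover have "abs_L2 v0 = abs_L2 v0'"
    unfolding abs_L2_eq_iff[OF sq(4) sq'(4)] using d00 by (intro AE_I2) (auto simp: u)
  ultimately show "x = y" using w(1) w'(1) by simp
qed

section \<open>Bounded solvability of the resolvent equation\<close>

lemma l2n_prim_le:
  assumes "prim f g" "f 0 = 0" shows "l2n f \<le> l2n g"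
proof (rule l2n_le_sup[OF prim_sq_int[OF assms(1)]])
  fix s :: real assume s: "s \<in> {0..1}"
  then have "f s = integral {0..s} g" using primD(2)[OF assms(1), of s] assms(2) by simp
  then show "cmod (f s) \<le> l2n g" using cmod_integral_le_l2n[OF primD(1)[OF assms(1)], of 0 s] s by simp
qed

text \<open>A trace estimate: take norms over s in f(1) = f(s) + (f(1) - f(s)). It bounds the datum
  \<kappa>f'(1) by the norm of X, which contains no point values.\<close>

lemma cmod_end_le:
  assumes "prim f g" shows "cmod (f 1) \<le> 2 * (l2n f + l2n g)"
proof -
  have sq: "square_integrable (\<lambda>s. f 1 - f s)"
    by (intro sq_int_minus prim_sq_int[OF prim_const] prim_sq_int[OF assms])
  have "cmod (f 1) = l2n (\<lambda>s. f s + (f 1 - f s))" by (simp add: l2n_const)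
  also have "\<dots> \<le> 2 * (l2n f + l2n (\<lambda>s. f 1 - f s))"
    by (rule l2n_add[OF prim_sq_int[OF assms] sq])
  also have "l2n (\<lambda>s. f 1 - f s) \<le> l2n g"
  proof (rule l2n_le_sup[OF sq])
    fix s :: real assume "s \<in> {0..1}"
    then show "cmod (f 1 - f s) \<le> l2n g"
      using prim_diff[OF assms, of s 1] cmod_integral_le_l2n[OF primD(1)[OF assms], of s 1] by simp
  qed
  finally show ?thesis by simp
qed

text \<open>The bound is proved for the constructed preimage; injectivity later identifies that
  preimage with the value of the inverse. The norms of f and f' are recovered from the weighted f'
  in the norm of X, since f(0) = 0.\<close>

lemma shifted_T_op_solvable:
  assumes nd: "T_nondeg \<beta> \<eta> \<kappa> \<gamma> z" and "0 \<le> \<beta> * \<eta>" "0 \<le> \<kappa>" "\<eta>\<^sup>2 < \<gamma>"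
  shows "\<exists>C. \<forall>y\<in>X_space. \<exists>x\<in>T_dom \<eta> \<kappa> \<gamma>. X_scale z x - T_op \<beta> \<eta> \<gamma> x = y \<and>
    X_norm \<eta> \<gamma> x \<le> C * X_norm \<eta> \<gamma> y"
proof -
  define \<alpha> where "\<alpha> = \<gamma> - \<eta>\<^sup>2"
  define B where "B = \<beta> * \<eta>"
  have \<alpha>: "0 < \<alpha>" and B: "0 \<le> B" using assms by (auto simp: \<alpha>_def B_def)
  obtain K where K: "0 \<le> K"
    "\<And>F d. square_integrable F \<Longrightarrow>
    \<exists>w0 w1 w2 w3. ode_sol (of_real \<alpha>) (2 * of_real B * z) (z\<^sup>2) F w0 w1 w2 w3 \<and> w0 0 = 0 \<and> w2 0 = 0 \<and>
       w2 1 + (of_real \<kappa> * z) * w1 1 = d \<and> w3 1 - of_real \<alpha> * w1 1 = 0 \<and>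
       (\<forall>s\<in>{0..1}. \<forall>w\<in>{w0,w1,w2,w3}. cmod (w s) \<le> K * (l2n F + cmod d))"
    by (rule solve_boundary_value_problem[OF nd[folded \<alpha>_def B_def]]) (rule that; assumption)
  \<comment> \<open>\<open>c\<close> undoes the weight \<alpha> on f', \<open>R\<close> bounds the
    data F and d, and \<open>C\<close> adds up the three parts of the norm of (w, v). Factors 2 in
    front of sums stem from \<open>l2n_add\<close>.\<close>
  define c where "c = 1 / sqrt \<alpha>"
  have c: "0 \<le> c" unfolding c_def using \<alpha> by simp
  define R where "R = 2 * (1 + 2 * (cmod z * c + 2 * B * c)) + \<kappa> * (2 * (c + 1))"
  define C where "C = K * R + sqrt \<alpha> * (K * R) + 2 * (cmod z * (K * R) + c)"
  show ?thesis
  proof (intro exI[of _ C] ballI)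
    fix y assume "y \<in> X_space"
    then obtain f g where y: "y = (f, g)" "(f, g) \<in> X_space" by (cases y) auto
    obtain f0 f1 f2 where f: "f = abs_L2 f0" "prim f0 f1" "prim f1 f2" "f0 0 = 0"
      using y(2) unfolding X_space_iff by blast
    obtain g0 where g: "square_integrable g0" "g = abs_L2 g0" by (rule abs_L2_cases)
    define n where "n = X_norm \<eta> \<gamma> y"
    have n: "n = sqrt ((l2n f2)\<^sup>2 + \<alpha> * (l2n f1)\<^sup>2 + (l2n g0)\<^sup>2)"
      unfolding n_def y(1) f(1) g(2) \<alpha>_def by (rule X_norm_abs_L2[OF f(2,3) g(1)])
    have n0: "0 \<le> n" unfolding n using \<alpha> by simp
    have nf2: "l2n f2 \<le> n" and ng: "l2n g0 \<le> n"
      unfolding n by (rule real_le_rsqrt, use \<alpha> in simp)+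
    have nf1: "l2n f1 \<le> c * n"
    proof -
      have "sqrt \<alpha> * l2n f1 \<le> n"
        unfolding n by (rule real_le_rsqrt) (use \<alpha> in \<open>simp add: power_mult_distrib\<close>)
      then show ?thesis using \<alpha> by (simp add: c_def field_simps)
    qed
    have nf0: "l2n f0 \<le> c * n" using l2n_prim_le[OF f(2,4)] nf1 by simp
    have f11: "cmod (f1 1) \<le> 2 * (c + 1) * n"
      using cmod_end_le[OF f(3)] nf1 nf2 by (simp add: algebra_simps)
    define F where "F s = g0 s + (z * f0 s + (2 * of_real B) * f1 s)" for s
    have sf: "square_integrable f0" "square_integrable f1" by (rule prim_sq_int f)+
    have sF: "square_integrable F"
      unfolding F_def by (intro square_integrable_add square_integrable_scale g sf)
    have nF: "l2n F \<le> 2 * (1 + 2 * (cmod z * c + 2 * B * c)) * n"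
    proof -
      have "l2n (\<lambda>s. z * f0 s + (2 * of_real B) * f1 s) \<le> 2 * (cmod z * l2n f0 + 2 * B * l2n f1)"
        using l2n_add[OF square_integrable_scale[OF sf(1), of z] square_integrable_scale[OF sf(2), of "2 * of_real B"]] B
        by (simp add: l2n_scale norm_mult)
      also have "\<dots> \<le> 2 * (cmod z * (c * n) + 2 * B * (c * n))"
        using nf0 nf1 B by (intro mult_left_mono add_mono) auto
      finally have *: "l2n (\<lambda>s. z * f0 s + (2 * of_real B) * f1 s) \<le> 2 * (cmod z * (c * n) + 2 * B * (c * n))" .
      have "l2n F \<le> 2 * (l2n g0 + l2n (\<lambda>s. z * f0 s + (2 * of_real B) * f1 s))"
        unfolding F_def by (intro l2n_add square_integrable_add square_integrable_scale g sf)
      then show ?thesis using * ng by (simp add: algebra_simps)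
    qed
    define d where "d = of_real \<kappa> * f1 1"
    have nR: "l2n F + cmod d \<le> R * n"
    proof -
      have "cmod d \<le> \<kappa> * (2 * (c + 1) * n)"
        unfolding d_def norm_mult using assms(3) mult_left_mono[OF f11 assms(3)] by simp
      then show ?thesis using nF by (simp add: R_def algebra_simps)
    qed
    obtain w0 w1 w2 w3 where w: "ode_sol (of_real \<alpha>) (2 * of_real B * z) (z\<^sup>2) F w0 w1 w2 w3" "w0 0 = 0" "w2 0 = 0"
       "w2 1 + (of_real \<kappa> * z) * w1 1 = d" "w3 1 - of_real \<alpha> * w1 1 = 0"
       "\<forall>s\<in>{0..1}. \<forall>w\<in>{w0,w1,w2,w3}. cmod (w s) \<le> K * (l2n F + cmod d)"
      using K(2)[OF sF, of d] by blast
    define w4 where "w4 = (\<lambda>s. F s + of_real \<alpha> * w2 s - 2 * of_real B * z * w1 s - z\<^sup>2 * w0 s)"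
    have p: "prim w0 w1" "prim w1 w2" "prim w2 w3" "prim w3 w4"
      using w(1) by (auto simp: ode_sol_def w4_def)
    define v0 v1 v2 where v: "v0 = (\<lambda>s. z * w0 s - f0 s)" "v1 = (\<lambda>s. z * w1 s - f1 s)" "v2 = (\<lambda>s. z * w2 s - f2 s)"
    have pv: "prim v0 v1" "prim v1 v2" unfolding v by (intro prim_minus prim_scale p f)+
    have dom: "(abs_L2 w0, abs_L2 v0) \<in> T_dom \<eta> \<kappa> \<gamma>"
    proof (rule T_domI[OF p pv])
      show "w0 0 = 0" "v0 0 = 0" "w2 0 = 0" using w f by (auto simp: v)
      show "w2 1 + of_real \<kappa> * v1 1 = 0" using w(4) by (simp add: v d_def algebra_simps)
      show "w3 1 - of_real (\<gamma> - \<eta>\<^sup>2) * w1 1 = 0" using w(5) by (simp add: \<alpha>_def)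
    qed
    have op: "X_scale z (abs_L2 w0, abs_L2 v0) - T_op \<beta> \<eta> \<gamma> (abs_L2 w0, abs_L2 v0) = y"
    proof -
      have "(\<lambda>s. z * w0 s - v0 s) = f0" by (simp add: v)
      moreover have "(\<lambda>s. z * v0 s + w4 s - of_real (\<gamma> - \<eta>\<^sup>2) * w2 s + 2 * of_real (\<beta> * \<eta>) * v1 s) = g0"
        unfolding \<alpha>_def[symmetric] B_def[symmetric] v w4_def F_def
        by (simp add: fun_eq_iff algebra_simps power2_eq_square)
      ultimately show ?thesis
        unfolding shifted_T_op_abs_L2[OF p pv(1)] y(1) f(1) g(2) by simp
    qed
    have wb: "l2n u \<le> K * R * n" if "u \<in> {w0, w1, w2}" for u
    proof (rule l2n_le_sup)
      show "square_integrable u" using that p prim_sq_int by blast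
      fix s :: real assume "s \<in> {0..1}"
      then have "cmod (u s) \<le> K * (l2n F + cmod d)" using w(6) that by blast
      also have "\<dots> \<le> K * (R * n)" using K(1) nR by (intro mult_left_mono) auto
      finally show "cmod (u s) \<le> K * R * n" by (simp add: mult.assoc)
    qed
    have vb: "l2n v0 \<le> 2 * (cmod z * (K * R) + c) * n"
    proof -
      have "l2n v0 \<le> 2 * (cmod z * l2n w0 + l2n f0)"
        using l2n_add[OF square_integrable_scale[OF prim_sq_int[OF p(1)], of z] square_integrable_scale[OF sf(1), of "-1"]]
          l2n_scale[of z w0] l2n_scale[of "-1" f0] by (simp add: v)
      also have "\<dots> \<le> 2 * (cmod z * (K * R * n) + c * n)"
        using wb[of w0] nf0 by (intro mult_left_mono add_mono) auto
      finally show ?thesis by (simp add: algebra_simps)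
    qed
    have "X_norm \<eta> \<gamma> (abs_L2 w0, abs_L2 v0) = sqrt ((l2n w2)\<^sup>2 + (sqrt \<alpha> * l2n w1)\<^sup>2 + (l2n v0)\<^sup>2)"
      using X_norm_abs_L2[OF p(1,2) prim_sq_int[OF pv(1)]] \<alpha> by (simp add: power_mult_distrib \<alpha>_def)
    also have "\<dots> \<le> l2n w2 + sqrt \<alpha> * l2n w1 + l2n v0"
    proof (rule real_le_lsqrt)
      have "0 \<le> l2n w2" "0 \<le> sqrt \<alpha> * l2n w1" "0 \<le> l2n v0" using \<alpha> by auto
      then show "(l2n w2)\<^sup>2 + (sqrt \<alpha> * l2n w1)\<^sup>2 + (l2n v0)\<^sup>2 \<le> (l2n w2 + sqrt \<alpha> * l2n w1 + l2n v0)\<^sup>2"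
        by (simp add: power2_sum mult_nonneg_nonneg add_nonneg_nonneg)
    qed (use \<alpha> in \<open>auto intro!: add_nonneg_nonneg\<close>)
    also have "\<dots> \<le> K * R * n + sqrt \<alpha> * (K * R * n) + 2 * (cmod z * (K * R) + c) * n"
      using wb[of w2] wb[of w1] vb \<alpha> by (intro add_mono mult_left_mono) auto
    also have "\<dots> = C * n" by (simp add: C_def algebra_simps)
    finally show "\<exists>x\<in>T_dom \<eta> \<kappa> \<gamma>. X_scale z x - T_op \<beta> \<eta> \<gamma> x = y \<and> X_norm \<eta> \<gamma> x \<le> C * X_norm \<eta> \<gamma> y"
      using dom op unfolding n_def by blast
  qed
qed

text \<open>The first component z w - v has to lie in H^2 and vanish at 0, which is where the domain
  conditions on v enter.\<close>

lemma T_op_maps_into: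
  assumes "x \<in> T_dom \<eta> \<kappa> \<gamma>"
  shows "X_scale z x - T_op \<beta> \<eta> \<gamma> x \<in> X_space"
  using assms
proof (rule T_domE)
  fix w0 w1 w2 w3 w4 v0 v1 v2
  assume x: "x = (abs_L2 w0, abs_L2 v0)" and p: "prim w0 w1" "prim w1 w2" "prim w2 w3" "prim w3 w4" "prim v0 v1" "prim v1 v2"
    and 0: "w0 0 = 0" "v0 0 = 0"
  show ?thesis unfolding x shifted_T_op_abs_L2[OF p(1-5)] X_space_iff
  proof (rule exI, rule exI, rule exI, intro conjI)
    show "prim (\<lambda>s. z * w0 s - v0 s) (\<lambda>s. z * w1 s - v1 s)" "prim (\<lambda>s. z * w1 s - v1 s) (\<lambda>s. z * w2 s - v2 s)"
      by (intro prim_minus prim_scale p)+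
  qed (use 0 in auto)
qed

section \<open>The spectrum as failure of uniqueness\<close>

lemma nondeg_imp_not_in_spectrum:
  assumes nd: "T_nondeg \<beta> \<eta> \<kappa> \<gamma> z" and "0 \<le> \<beta> * \<eta>" "0 \<le> \<kappa>" "\<eta>\<^sup>2 < \<gamma>"
  shows "z \<notin> T_spectrum \<beta> \<eta> \<kappa> \<gamma>"
proof -
  let ?h = "\<lambda>x. X_scale z x - T_op \<beta> \<eta> \<gamma> x" and ?D = "T_dom \<eta> \<kappa> \<gamma>"
  have inj: "inj_on ?h ?D" by (rule shifted_T_op_inj[OF nd])
  obtain C where C: "\<And>y. y \<in> X_space \<Longrightarrow> \<exists>x\<in>?D. ?h x = y \<and> X_norm \<eta> \<gamma> x \<le> C * X_norm \<eta> \<gamma> y"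
    using shifted_T_op_solvable[OF assms] by blast
  have "?h ` ?D = X_space"
  proof
    show "?h ` ?D \<subseteq> X_space" using T_op_maps_into by blast
    show "X_space \<subseteq> ?h ` ?D" using C by blast
  qed
  moreover have "X_norm \<eta> \<gamma> (inv_into ?D ?h y) \<le> C * X_norm \<eta> \<gamma> y" if "y \<in> X_space" for y
  proof -
    obtain x where "x \<in> ?D" "?h x = y" "X_norm \<eta> \<gamma> x \<le> C * X_norm \<eta> \<gamma> y" using C \<open>y \<in> X_space\<close> by blast
    then show ?thesis using inv_into_f_f[OF inj, of x] by simp
  qed
  ultimately show ?thesis
    using inj unfolding T_spectrum_def spectrum_def resolvent_set_def bij_betw_def by blast
qed

text \<open>A nontrivial solution w yields the eigenvector (w, z w). It has the same image under zI
  - T as the zero element of the domain, so injectivity fails.\<close>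

lemma degenerate_imp_in_spectrum:
  assumes "\<not> T_nondeg \<beta> \<eta> \<kappa> \<gamma> z"
  shows "z \<in> T_spectrum \<beta> \<eta> \<kappa> \<gamma>"
proof -
  let ?h = "\<lambda>x. X_scale z x - T_op \<beta> \<eta> \<gamma> x" and ?D = "T_dom \<eta> \<kappa> \<gamma>"
  obtain w0 w1 w2 w3 s where w: "ode_sol (of_real (\<gamma> - \<eta>\<^sup>2)) (2 * of_real (\<beta> * \<eta>) * z) (z\<^sup>2) (\<lambda>_. 0) w0 w1 w2 w3"
      "w0 0 = 0" "w2 0 = 0" "w2 1 + of_real \<kappa> * z * w1 1 = 0" "w3 1 - of_real (\<gamma> - \<eta>\<^sup>2) * w1 1 = 0"
    and s: "s \<in> {0..1}" "w0 s \<noteq> 0"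
    using assms unfolding nondeg_def by blast
  define w4 where "w4 = (\<lambda>s. 0 + of_real (\<gamma> - \<eta>\<^sup>2) * w2 s - 2 * of_real (\<beta> * \<eta>) * z * w1 s - z\<^sup>2 * w0 s)"
  have p: "prim w0 w1" "prim w1 w2" "prim w2 w3" "prim w3 w4"
    using w(1) by (auto simp: ode_sol_def w4_def)
  note pz = prim_scale[OF p(1), of z] prim_scale[OF p(2), of z]
  note p0 = prim_const[of 0]
  have x: "(abs_L2 w0, abs_L2 (\<lambda>s. z * w0 s)) \<in> ?D"
    by (rule T_domI[OF p pz]) (use w in \<open>auto simp: mult.assoc\<close>)
  have o: "(abs_L2 (\<lambda>_. 0), abs_L2 (\<lambda>_. 0)) \<in> ?D"
    by (rule T_domI[OF p0 p0 p0 p0 p0 p0]) auto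
  have "?h (abs_L2 w0, abs_L2 (\<lambda>s. z * w0 s)) = ?h (abs_L2 (\<lambda>_. 0), abs_L2 (\<lambda>_. 0))"
    unfolding shifted_T_op_abs_L2[OF p pz(1)] shifted_T_op_abs_L2[OF p0 p0 p0 p0 p0] w4_def
    by (simp add: algebra_simps power2_eq_square)
  moreover have "abs_L2 w0 \<noteq> abs_L2 (\<lambda>_. 0)"
  proof
    assume "abs_L2 w0 = abs_L2 (\<lambda>_. 0)"
    then have "AE s in unit_ivl. w0 s = 0"
      using abs_L2_eq_iff[OF prim_sq_int[OF p(1)] square_integrable_zero] by simp
    then show False
      using continuous_AE_eq[OF prim_continuous[OF p(1)] continuous_on_const _ s(1)] s(2) by blast
  qed
  ultimately have "\<not> inj_on ?h ?D" using x o unfolding inj_on_def by blast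
  then show ?thesis
    unfolding T_spectrum_def spectrum_def resolvent_set_def bij_betw_def by blast
qed

theorem theorem3p1:
  fixes \<beta> \<eta> \<kappa> \<gamma> :: real
  assumes "0 < \<beta>" and "\<beta> < 1" and "0 \<le> \<eta>" and "0 \<le> \<kappa>" and "\<eta>\<^sup>2 < \<gamma>"
  shows "cnj ` T_spectrum \<beta> \<eta> \<kappa> \<gamma> = T_spectrum \<beta> \<eta> \<kappa> \<gamma> \<and>
         T_spectrum \<beta> \<eta> \<kappa> \<gamma> \<subseteq> {z. Re z \<le> 0} - {0} \<and>
         (0 < \<eta> \<and> 0 < \<kappa> \<longrightarrow> T_spectrum \<beta> \<eta> \<kappa> \<gamma> \<subseteq> {z. Re z < 0})"
proof -
  have nonneg: "0 \<le> \<beta> * \<eta>" and \<alpha>: "0 < \<gamma> - \<eta>\<^sup>2" using assms by auto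
  \<comment> \<open>Turns all three claims into statements about the homogeneous problem; every
    spectral value is thereby an eigenvalue.\<close>
  have spec: "z \<in> T_spectrum \<beta> \<eta> \<kappa> \<gamma> \<longleftrightarrow> \<not> T_nondeg \<beta> \<eta> \<kappa> \<gamma> z" for z
    using nondeg_imp_not_in_spectrum[OF _ nonneg assms(4,5)] degenerate_imp_in_spectrum by blast
  have cnj: "T_nondeg \<beta> \<eta> \<kappa> \<gamma> (cnj z)" if "T_nondeg \<beta> \<eta> \<kappa> \<gamma> z" for z
    using nondeg_cnj[OF that] by simp
  have mem: "cnj z \<in> T_spectrum \<beta> \<eta> \<kappa> \<gamma>" if "z \<in> T_spectrum \<beta> \<eta> \<kappa> \<gamma>" for z
    using that cnj[of "cnj z"] unfolding spec by auto
  have "cnj ` T_spectrum \<beta> \<eta> \<kappa> \<gamma> = T_spectrum \<beta> \<eta> \<kappa> \<gamma>"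
  proof
    show "cnj ` T_spectrum \<beta> \<eta> \<kappa> \<gamma> \<subseteq> T_spectrum \<beta> \<eta> \<kappa> \<gamma>" using mem by blast
    show "T_spectrum \<beta> \<eta> \<kappa> \<gamma> \<subseteq> cnj ` T_spectrum \<beta> \<eta> \<kappa> \<gamma>"
    proof
      fix z assume "z \<in> T_spectrum \<beta> \<eta> \<kappa> \<gamma>"
      then have "cnj (cnj z) \<in> cnj ` T_spectrum \<beta> \<eta> \<kappa> \<gamma>" using mem by blast
      then show "z \<in> cnj ` T_spectrum \<beta> \<eta> \<kappa> \<gamma>" by simp
    qed
  qed
  moreover have "Re z \<le> 0" if "z \<in> T_spectrum \<beta> \<eta> \<kappa> \<gamma>" for z
    using that nondeg_right_half_plane[of "\<gamma> - \<eta>\<^sup>2" "\<beta> * \<eta>" \<kappa> z] \<alpha> nonneg assms(4) unfolding spec by force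
  moreover have "0 \<notin> T_spectrum \<beta> \<eta> \<kappa> \<gamma>"
    using nondeg_origin[OF \<alpha>] unfolding spec by simp
  moreover have "Re z < 0" if "0 < \<eta>" "0 < \<kappa>" "z \<in> T_spectrum \<beta> \<eta> \<kappa> \<gamma>" for z
  proof (rule ccontr)
    assume "\<not> Re z < 0"
    moreover have "z \<noteq> 0" using that(3) \<open>0 \<notin> T_spectrum \<beta> \<eta> \<kappa> \<gamma>\<close> by blast
    ultimately have "T_nondeg \<beta> \<eta> \<kappa> \<gamma> z"
      using \<alpha> assms(1) that by (intro nondeg_closed_right_half_plane) auto
    then show False using that(3) unfolding spec by blast
  qed
  ultimately show ?thesis by blast
qed

end
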